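(* Let $E:\mathcal{U}$ and $\mathsf{List},\mathsf{nil},\mathsf{cons},\mathsf{rec}_{\mathsf{l}},\mathsf{MorphList}$ be as in the context. For all $X:\mathcal{U}$, $x:X$, $g:E\to X\to X$ and $f:\mathsf{List}\to X$, $$\mathsf{MorphList}\ \mathsf{List}\ \mathsf{nil}\ \mathsf{cons}\ \ X\ x\ g\ \ f \ \to\ f = \mathsf{rec}_{\mathsf{l}}\,X\,x\,g .$$
   Context: Type theory: intensional Martin-Löf type theory with a cumulative hierarchy of universes $\mathcal{U} : \mathcal{U}_0 : \mathcal{U}_1 : \cdots$, where the bottom universe $\mathcal{U}$ is impredicative (if $A$ is a type in any universe and $a:A\vdash B:\mathcal{U}$, then $\prod_{a:A}B : \mathcal{U}$), all universes closed under $\Sigma$-types and intensional identity types $=$; $A\to B$, $A\times B$ non-dependent $\Pi$, $\Sigma$; $\pi_1,\pi_2$ projections; $f\circ g:=\lambda x.f(g\,x)$. Axioms: function extensionality and UIP. Fix $E:\mathcal{U}$. $\mathsf{List}^* := \prod_{X:\mathcal{U}} X\to(E\to X\to X)\to X$, $\mathsf{nil}^* := \lambda X\,x\,f.\,x$, $\mathsf{cons}^*\,e\,l := \lambda X\,x\,f.\ f\,e\,(l\,X\,x\,f)$, $\mathsf{rec}^*\,X\,x\,g\,l := l\,X\,x\,g$. $\mathsf{MorphList}\,X\,x\,g\ Y\,y\,h\ f := (f\,x = y)\times \prod_{e:E} f\circ(g\,e) = (h\,e)\circ f$ for $f:X\to Y$, $g:E\to X\to X$, $h:E\to Y\to Y$.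 $\mathsf{LimList}\,l := \prod_{X,Y:\mathcal{U}}\prod_{x:X,y:Y}\prod_{f:X\to Y}\prod_{g,h} \mathsf{MorphList}\,X\,x\,g\ Y\,y\,h\ f \to f(\mathsf{rec}^*\,X\,x\,g\,l) = \mathsf{rec}^*\,Y\,y\,h\,l$. $\mathsf{List} := \sum_{l:\mathsf{List}^*}\mathsf{LimList}\,l$. With proofs $p_0 : \mathsf{LimList}\,\mathsf{nil}^*$ and $p_c : \prod_{e,l}\mathsf{LimList}(\mathsf{cons}^*\,e\,(\pi_1 l))$ (which exist), $\mathsf{nil} := \langle \mathsf{nil}^*, p_0\rangle$, $\mathsf{cons}\,e\,l := \langle\mathsf{cons}^*\,e\,(\pi_1 l), p_c\,e\,l\rangle$, $\mathsf{rec}_{\mathsf{l}}\,X\,x\,g\,l := \mathsf{rec}^*\,X\,x\,g\,(\pi_1 l)$. *)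

theory Defs
  imports Main
begin

text \<open>
  A deep embedding, with de Bruijn indices, of intensional Martin-Loef type theory with a
  cumulative hierarchy of universes whose bottom universe is impredicative.  The rules are those
  of the formal presentation of type theory in the appendix of the HoTT book (Pi-types with beta
  and eta, Sigma-types and identity types with their dependent eliminators, all universes a la
  Russell), plus impredicativity of the bottom universe (rule \<open>ty_Pi_impred\<close>) and, as the two
  axioms, constants for function extensionality and uniqueness of identity proofs, which have
  typing and congruence rules but no computation rule.
  \<open>Univ 0\<close> is the impredicative universe and \<open>Univ (Suc i)\<close> is the universe usually written
  with index \<open>i\<close>.
\<close>

datatype tm =
    Var nat
  | Univ nat
  | Pi tm tm            \<comment> \<open>binds 1 variable in the second argument\<close>
  | Lam tm tm           \<comment> \<open>domain; binds 1 variable in the body\<close>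
  | App tm tm
  | Sig tm tm           \<comment> \<open>binds 1 variable in the second argument\<close>
  | Pair tm tm
  | Split tm tm tm      \<comment> \<open>motive (binds 1), branch (binds 2), scrutinee\<close>
  | Id tm tm tm         \<comment> \<open>type, left end, right end\<close>
  | Refl tm
  | J tm tm tm tm tm    \<comment> \<open>motive (binds 3), branch (binds 1), left end, right end, path\<close>
  | Funext tm tm tm     \<comment> \<open>two functions, pointwise equality\<close>
  | UIP tm tm           \<comment> \<open>two paths with the same ends\<close>

definition up :: "(nat \<Rightarrow> nat) \<Rightarrow> nat \<Rightarrow> nat" where
  "up r = case_nat 0 (\<lambda>n. Suc (r n))"

primrec ren :: "(nat \<Rightarrow> nat) \<Rightarrow> tm \<Rightarrow> tm" where
  "ren r (Var n) = Var (r n)"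
| "ren r (Univ i) = Univ i"
| "ren r (Pi A B) = Pi (ren r A) (ren (up r) B)"
| "ren r (Lam A b) = Lam (ren r A) (ren (up r) b)"
| "ren r (App f a) = App (ren r f) (ren r a)"
| "ren r (Sig A B) = Sig (ren r A) (ren (up r) B)"
| "ren r (Pair a b) = Pair (ren r a) (ren r b)"
| "ren r (Split C c p) = Split (ren (up r) C) (ren (up (up r)) c) (ren r p)"
| "ren r (Id A a b) = Id (ren r A) (ren r a) (ren r b)"
| "ren r (Refl a) = Refl (ren r a)"
| "ren r (J C c a b p) =
     J (ren (up (up (up r))) C) (ren (up r) c) (ren r a) (ren r b) (ren r p)"
| "ren r (Funext f g h) = Funext (ren r f) (ren r g) (ren r h)"
| "ren r (UIP p q) = UIP (ren r p) (ren r q)"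

abbreviation shift :: "tm \<Rightarrow> tm" where
  "shift \<equiv> ren Suc"

definition scons :: "tm \<Rightarrow> (nat \<Rightarrow> tm) \<Rightarrow> nat \<Rightarrow> tm" (infixr "\<bullet>" 55) where
  "t \<bullet> s = case_nat t s"

definition ups :: "(nat \<Rightarrow> tm) \<Rightarrow> nat \<Rightarrow> tm" where
  "ups s = Var 0 \<bullet> (\<lambda>n. shift (s n))"

primrec sub :: "(nat \<Rightarrow> tm) \<Rightarrow> tm \<Rightarrow> tm" where
  "sub s (Var n) = s n"
| "sub s (Univ i) = Univ i"
| "sub s (Pi A B) = Pi (sub s A) (sub (ups s) B)"
| "sub s (Lam A b) = Lam (sub s A) (sub (ups s) b)"
| "sub s (App f a) = App (sub s f) (sub s a)"
| "sub s (Sig A B) = Sig (sub s A) (sub (ups s) B)"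
| "sub s (Pair a b) = Pair (sub s a) (sub s b)"
| "sub s (Split C c p) = Split (sub (ups s) C) (sub (ups (ups s)) c) (sub s p)"
| "sub s (Id A a b) = Id (sub s A) (sub s a) (sub s b)"
| "sub s (Refl a) = Refl (sub s a)"
| "sub s (J C c a b p) =
     J (sub (ups (ups (ups s))) C) (sub (ups s) c) (sub s a) (sub s b) (sub s p)"
| "sub s (Funext f g h) = Funext (sub s f) (sub s g) (sub s h)"
| "sub s (UIP p q) = UIP (sub s p) (sub s q)"

text \<open>Instantiation of the last one, two or three variables, the most recent one first.\<close>

abbreviation inst1 :: "tm \<Rightarrow> tm \<Rightarrow> tm" where
  "inst1 t a \<equiv> sub (a \<bullet> Var) t"

abbreviation inst2 :: "tm \<Rightarrow> tm \<Rightarrow> tm \<Rightarrow> tm" where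
  "inst2 t b a \<equiv> sub (b \<bullet> a \<bullet> Var) t"

abbreviation inst3 :: "tm \<Rightarrow> tm \<Rightarrow> tm \<Rightarrow> tm \<Rightarrow> tm" where
  "inst3 t p b a \<equiv> sub (p \<bullet> b \<bullet> a \<bullet> Var) t"

text \<open>
  For \<open>C\<close> over \<open>\<Gamma>, z : \<Sigma> A B\<close>, the type \<open>split_ty C\<close> over \<open>\<Gamma>, x : A, y : B\<close> is \<open>C[(x, y)/z]\<close>.
  For \<open>C\<close> over \<open>\<Gamma>, x : A, y : A, p : x = y\<close>, the type \<open>J_ty C\<close> over \<open>\<Gamma>, z : A\<close> is
  \<open>C[z/x, z/y, refl z/p]\<close>.
\<close>

definition split_ty :: "tm \<Rightarrow> tm" where
  "split_ty C = sub (Pair (Var 1) (Var 0) \<bullet> (\<lambda>n. Var (Suc (Suc n)))) C"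

definition J_ty :: "tm \<Rightarrow> tm" where
  "J_ty C = sub (Refl (Var 0) \<bullet> Var 0 \<bullet> Var 0 \<bullet> (\<lambda>n. Var (Suc n))) C"

text \<open>Contexts are lists of types, the most recent declaration first.\<close>

type_synonym ctx = "tm list"

abbreviation J_ctx :: "tm \<Rightarrow> ctx \<Rightarrow> ctx" where
  "J_ctx A \<Gamma> \<equiv> Id (shift (shift A)) (Var 1) (Var 0) # shift A # A # \<Gamma>"

text \<open>The type of pointwise equalities between \<open>f\<close> and \<open>g\<close>, both of type \<open>Pi A B\<close>.\<close>

abbreviation pointwise :: "tm \<Rightarrow> tm \<Rightarrow> tm \<Rightarrow> tm \<Rightarrow> tm" where
  "pointwise A B f g \<equiv> Pi A (Id B (App (shift f) (Var 0)) (App (shift g) (Var 0)))"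

inductive
  wf_ctx :: "ctx \<Rightarrow> bool" and
  has_type :: "ctx \<Rightarrow> tm \<Rightarrow> tm \<Rightarrow> bool" ("_ \<turnstile> _ : _" [51, 51, 51] 50) and
  eq_tm :: "ctx \<Rightarrow> tm \<Rightarrow> tm \<Rightarrow> tm \<Rightarrow> bool" ("_ \<turnstile> _ \<equiv> _ : _" [51, 51, 51, 51] 50)
where
  ctx_nil: "wf_ctx []"
| ctx_cons: "wf_ctx \<Gamma> \<Longrightarrow> \<Gamma> \<turnstile> A : Univ i \<Longrightarrow> wf_ctx (A # \<Gamma>)"

| ty_var: "wf_ctx \<Gamma> \<Longrightarrow> n < length \<Gamma> \<Longrightarrow> \<Gamma> \<turnstile> Var n : ren (\<lambda>m. m + Suc n) (\<Gamma> ! n)"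
| ty_conv: "\<Gamma> \<turnstile> a : A \<Longrightarrow> \<Gamma> \<turnstile> A \<equiv> B : Univ i \<Longrightarrow> \<Gamma> \<turnstile> a : B"
| ty_univ: "wf_ctx \<Gamma> \<Longrightarrow> \<Gamma> \<turnstile> Univ i : Univ (Suc i)"
| ty_cumul: "\<Gamma> \<turnstile> A : Univ i \<Longrightarrow> \<Gamma> \<turnstile> A : Univ (Suc i)"
| ty_Pi: "\<Gamma> \<turnstile> A : Univ i \<Longrightarrow> A # \<Gamma> \<turnstile> B : Univ i \<Longrightarrow> \<Gamma> \<turnstile> Pi A B : Univ i"
| ty_Pi_impred: "\<Gamma> \<turnstile> A : Univ i \<Longrightarrow> A # \<Gamma> \<turnstile> B : Univ 0 \<Longrightarrow> \<Gamma> \<turnstile> Pi A B : Univ 0"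
| ty_Lam: "\<Gamma> \<turnstile> A : Univ i \<Longrightarrow> A # \<Gamma> \<turnstile> b : B \<Longrightarrow> \<Gamma> \<turnstile> Lam A b : Pi A B"
| ty_App: "\<Gamma> \<turnstile> f : Pi A B \<Longrightarrow> \<Gamma> \<turnstile> a : A \<Longrightarrow> \<Gamma> \<turnstile> App f a : inst1 B a"
| ty_Sig: "\<Gamma> \<turnstile> A : Univ i \<Longrightarrow> A # \<Gamma> \<turnstile> B : Univ i \<Longrightarrow> \<Gamma> \<turnstile> Sig A B : Univ i"
| ty_Pair: "\<Gamma> \<turnstile> A : Univ i \<Longrightarrow> A # \<Gamma> \<turnstile> B : Univ j \<Longrightarrow> \<Gamma> \<turnstile> a : A \<Longrightarrow> \<Gamma> \<turnstile> b : inst1 B a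
    \<Longrightarrow> \<Gamma> \<turnstile> Pair a b : Sig A B"
| ty_Split: "\<Gamma> \<turnstile> A : Univ i \<Longrightarrow> A # \<Gamma> \<turnstile> B : Univ j \<Longrightarrow> Sig A B # \<Gamma> \<turnstile> C : Univ k
    \<Longrightarrow> B # A # \<Gamma> \<turnstile> c : split_ty C \<Longrightarrow> \<Gamma> \<turnstile> p : Sig A B
    \<Longrightarrow> \<Gamma> \<turnstile> Split C c p : inst1 C p"
| ty_Id: "\<Gamma> \<turnstile> A : Univ i \<Longrightarrow> \<Gamma> \<turnstile> a : A \<Longrightarrow> \<Gamma> \<turnstile> b : A \<Longrightarrow> \<Gamma> \<turnstile> Id A a b : Univ i"
| ty_Refl: "\<Gamma> \<turnstile> A : Univ i \<Longrightarrow> \<Gamma> \<turnstile> a : A \<Longrightarrow> \<Gamma> \<turnstile> Refl a : Id A a a"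
| ty_J: "\<Gamma> \<turnstile> A : Univ i \<Longrightarrow> J_ctx A \<Gamma> \<turnstile> C : Univ k \<Longrightarrow> A # \<Gamma> \<turnstile> c : J_ty C
    \<Longrightarrow> \<Gamma> \<turnstile> a : A \<Longrightarrow> \<Gamma> \<turnstile> b : A \<Longrightarrow> \<Gamma> \<turnstile> p : Id A a b
    \<Longrightarrow> \<Gamma> \<turnstile> J C c a b p : inst3 C p b a"
| ty_Funext: "\<Gamma> \<turnstile> A : Univ i \<Longrightarrow> A # \<Gamma> \<turnstile> B : Univ j \<Longrightarrow> \<Gamma> \<turnstile> f : Pi A B \<Longrightarrow> \<Gamma> \<turnstile> g : Pi A B
    \<Longrightarrow> \<Gamma> \<turnstile> h : pointwise A B f g \<Longrightarrow> \<Gamma> \<turnstile> Funext f g h : Id (Pi A B) f g"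
| ty_UIP: "\<Gamma> \<turnstile> A : Univ i \<Longrightarrow> \<Gamma> \<turnstile> a : A \<Longrightarrow> \<Gamma> \<turnstile> b : A \<Longrightarrow> \<Gamma> \<turnstile> p : Id A a b
    \<Longrightarrow> \<Gamma> \<turnstile> q : Id A a b \<Longrightarrow> \<Gamma> \<turnstile> UIP p q : Id (Id A a b) p q"

| eq_refl: "\<Gamma> \<turnstile> a : A \<Longrightarrow> \<Gamma> \<turnstile> a \<equiv> a : A"
| eq_sym: "\<Gamma> \<turnstile> a \<equiv> b : A \<Longrightarrow> \<Gamma> \<turnstile> b \<equiv> a : A"
| eq_trans: "\<Gamma> \<turnstile> a \<equiv> b : A \<Longrightarrow> \<Gamma> \<turnstile> b \<equiv> c : A \<Longrightarrow> \<Gamma> \<turnstile> a \<equiv> c : A"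
| eq_conv: "\<Gamma> \<turnstile> a \<equiv> b : A \<Longrightarrow> \<Gamma> \<turnstile> A \<equiv> B : Univ i \<Longrightarrow> \<Gamma> \<turnstile> a \<equiv> b : B"
| eq_cumul: "\<Gamma> \<turnstile> A \<equiv> B : Univ i \<Longrightarrow> \<Gamma> \<turnstile> A \<equiv> B : Univ (Suc i)"

| eq_beta: "\<Gamma> \<turnstile> A : Univ i \<Longrightarrow> A # \<Gamma> \<turnstile> b : B \<Longrightarrow> \<Gamma> \<turnstile> a : A
    \<Longrightarrow> \<Gamma> \<turnstile> App (Lam A b) a \<equiv> inst1 b a : inst1 B a"
| eq_eta: "\<Gamma> \<turnstile> A : Univ i \<Longrightarrow> A # \<Gamma> \<turnstile> B : Univ j \<Longrightarrow> \<Gamma> \<turnstile> f : Pi A B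
    \<Longrightarrow> \<Gamma> \<turnstile> f \<equiv> Lam A (App (shift f) (Var 0)) : Pi A B"
| eq_Split_Pair: "\<Gamma> \<turnstile> A : Univ i \<Longrightarrow> A # \<Gamma> \<turnstile> B : Univ j \<Longrightarrow> Sig A B # \<Gamma> \<turnstile> C : Univ k
    \<Longrightarrow> B # A # \<Gamma> \<turnstile> c : split_ty C \<Longrightarrow> \<Gamma> \<turnstile> a : A \<Longrightarrow> \<Gamma> \<turnstile> b : inst1 B a
    \<Longrightarrow> \<Gamma> \<turnstile> Split C c (Pair a b) \<equiv> inst2 c b a : inst1 C (Pair a b)"
| eq_J_Refl: "\<Gamma> \<turnstile> A : Univ i \<Longrightarrow> J_ctx A \<Gamma> \<turnstile> C : Univ k \<Longrightarrow> A # \<Gamma> \<turnstile> c : J_ty C \<Longrightarrow> \<Gamma> \<turnstile> a : A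
    \<Longrightarrow> \<Gamma> \<turnstile> J C c a a (Refl a) \<equiv> inst1 c a : inst3 C (Refl a) a a"

| eq_Pi: "\<Gamma> \<turnstile> A : Univ i \<Longrightarrow> \<Gamma> \<turnstile> A \<equiv> A' : Univ i \<Longrightarrow> A # \<Gamma> \<turnstile> B \<equiv> B' : Univ i
    \<Longrightarrow> \<Gamma> \<turnstile> Pi A B \<equiv> Pi A' B' : Univ i"
| eq_Pi_impred: "\<Gamma> \<turnstile> A : Univ i \<Longrightarrow> \<Gamma> \<turnstile> A \<equiv> A' : Univ i \<Longrightarrow> A # \<Gamma> \<turnstile> B \<equiv> B' : Univ 0
    \<Longrightarrow> \<Gamma> \<turnstile> Pi A B \<equiv> Pi A' B' : Univ 0"
| eq_Lam: "\<Gamma> \<turnstile> A : Univ i \<Longrightarrow> \<Gamma> \<turnstile> A \<equiv> A' : Univ i \<Longrightarrow> A # \<Gamma> \<turnstile> b \<equiv> b' : B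
    \<Longrightarrow> \<Gamma> \<turnstile> Lam A b \<equiv> Lam A' b' : Pi A B"
| eq_App: "\<Gamma> \<turnstile> f \<equiv> f' : Pi A B \<Longrightarrow> \<Gamma> \<turnstile> a \<equiv> a' : A \<Longrightarrow> \<Gamma> \<turnstile> App f a \<equiv> App f' a' : inst1 B a"
| eq_Sig: "\<Gamma> \<turnstile> A : Univ i \<Longrightarrow> \<Gamma> \<turnstile> A \<equiv> A' : Univ i \<Longrightarrow> A # \<Gamma> \<turnstile> B \<equiv> B' : Univ i
    \<Longrightarrow> \<Gamma> \<turnstile> Sig A B \<equiv> Sig A' B' : Univ i"
| eq_Pair: "\<Gamma> \<turnstile> A : Univ i \<Longrightarrow> A # \<Gamma> \<turnstile> B : Univ j \<Longrightarrow> \<Gamma> \<turnstile> a \<equiv> a' : A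
    \<Longrightarrow> \<Gamma> \<turnstile> b \<equiv> b' : inst1 B a \<Longrightarrow> \<Gamma> \<turnstile> Pair a b \<equiv> Pair a' b' : Sig A B"
| eq_Split: "\<Gamma> \<turnstile> A : Univ i \<Longrightarrow> A # \<Gamma> \<turnstile> B : Univ j \<Longrightarrow> Sig A B # \<Gamma> \<turnstile> C \<equiv> C' : Univ k
    \<Longrightarrow> B # A # \<Gamma> \<turnstile> c \<equiv> c' : split_ty C \<Longrightarrow> \<Gamma> \<turnstile> p \<equiv> p' : Sig A B
    \<Longrightarrow> \<Gamma> \<turnstile> Split C c p \<equiv> Split C' c' p' : inst1 C p"
| eq_Id: "\<Gamma> \<turnstile> A \<equiv> A' : Univ i \<Longrightarrow> \<Gamma> \<turnstile> a \<equiv> a' : A \<Longrightarrow> \<Gamma> \<turnstile> b \<equiv> b' : A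
    \<Longrightarrow> \<Gamma> \<turnstile> Id A a b \<equiv> Id A' a' b' : Univ i"
| eq_Refl: "\<Gamma> \<turnstile> A : Univ i \<Longrightarrow> \<Gamma> \<turnstile> a \<equiv> a' : A \<Longrightarrow> \<Gamma> \<turnstile> Refl a \<equiv> Refl a' : Id A a a"
| eq_J: "\<Gamma> \<turnstile> A : Univ i \<Longrightarrow> J_ctx A \<Gamma> \<turnstile> C \<equiv> C' : Univ k \<Longrightarrow> A # \<Gamma> \<turnstile> c \<equiv> c' : J_ty C
    \<Longrightarrow> \<Gamma> \<turnstile> a \<equiv> a' : A \<Longrightarrow> \<Gamma> \<turnstile> b \<equiv> b' : A \<Longrightarrow> \<Gamma> \<turnstile> p \<equiv> p' : Id A a b
    \<Longrightarrow> \<Gamma> \<turnstile> J C c a b p \<equiv> J C' c' a' b' p' : inst3 C p b a"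
| eq_Funext: "\<Gamma> \<turnstile> A : Univ i \<Longrightarrow> A # \<Gamma> \<turnstile> B : Univ j \<Longrightarrow> \<Gamma> \<turnstile> f \<equiv> f' : Pi A B
    \<Longrightarrow> \<Gamma> \<turnstile> g \<equiv> g' : Pi A B \<Longrightarrow> \<Gamma> \<turnstile> h \<equiv> h' : pointwise A B f g
    \<Longrightarrow> \<Gamma> \<turnstile> Funext f g h \<equiv> Funext f' g' h' : Id (Pi A B) f g"
| eq_UIP: "\<Gamma> \<turnstile> A : Univ i \<Longrightarrow> \<Gamma> \<turnstile> a : A \<Longrightarrow> \<Gamma> \<turnstile> b : A \<Longrightarrow> \<Gamma> \<turnstile> p \<equiv> p' : Id A a b
    \<Longrightarrow> \<Gamma> \<turnstile> q \<equiv> q' : Id A a b \<Longrightarrow> \<Gamma> \<turnstile> UIP p q \<equiv> UIP p' q' : Id (Id A a b) p q"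


text \<open>
  To write terms with bound variables of the metalanguage, an expression is a function from the
  number \<open>k\<close> of variables in scope to a de Bruijn term.  A variable is identified by its level
  \<open>l\<close>, counted from the outermost declaration of the context, so that its index under \<open>k\<close>
  variables is \<open>k - Suc l\<close>.  A binder met at depth \<open>k\<close> binds the variable of level \<open>k\<close>.
  Weakening is thus implicit: \<open>B\<close> may be used under any number of further binders.  An
  expression \<open>t\<close> is evaluated in a context \<open>\<Gamma>\<close> as \<open>t (length \<Gamma>)\<close>.
\<close>

type_synonym expr = "nat \<Rightarrow> tm"

definition var :: "nat \<Rightarrow> expr" where
  "var l k = Var (k - Suc l)"

definition UNIV0 :: expr ("\<U>") where
  "\<U> k = Univ 0"

definition PI :: "expr \<Rightarrow> (expr \<Rightarrow> expr) \<Rightarrow> expr" where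
  "PI A B k = Pi (A k) (B (var k) (Suc k))"

definition LAM :: "expr \<Rightarrow> (expr \<Rightarrow> expr) \<Rightarrow> expr" where
  "LAM A b k = Lam (A k) (b (var k) (Suc k))"

definition APP :: "expr \<Rightarrow> expr \<Rightarrow> expr" (infixl "\<cdot>" 90) where
  "(f \<cdot> a) k = App (f k) (a k)"

definition SIG :: "expr \<Rightarrow> (expr \<Rightarrow> expr) \<Rightarrow> expr" where
  "SIG A B k = Sig (A k) (B (var k) (Suc k))"

definition PAIR :: "expr \<Rightarrow> expr \<Rightarrow> expr" ("\<langle>_, _\<rangle>") where
  "\<langle>a, b\<rangle> k = Pair (a k) (b k)"

definition SPLIT :: "(expr \<Rightarrow> expr) \<Rightarrow> (expr \<Rightarrow> expr \<Rightarrow> expr) \<Rightarrow> expr \<Rightarrow> expr" where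
  "SPLIT C c p k = Split (C (var k) (Suc k)) (c (var k) (var (Suc k)) (Suc (Suc k))) (p k)"

definition ID :: "expr \<Rightarrow> expr \<Rightarrow> expr \<Rightarrow> expr" where
  "ID A a b k = Id (A k) (a k) (b k)"

syntax
  "_PI" :: "pttrn \<Rightarrow> logic \<Rightarrow> logic \<Rightarrow> logic"  ("(3\<Pi> _ : _./ _)" [0, 61, 60] 60)
  "_LAM" :: "pttrn \<Rightarrow> logic \<Rightarrow> logic \<Rightarrow> logic"  ("(3\<Lambda> _ : _./ _)" [0, 61, 60] 60)
  "_SIG" :: "pttrn \<Rightarrow> logic \<Rightarrow> logic \<Rightarrow> logic"  ("(3\<Sigma> _ : _./ _)" [0, 61, 60] 60)
translations
  "\<Pi> x : A. B" \<rightleftharpoons> "CONST PI A (\<lambda>x. B)"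
  "\<Lambda> x : A. B" \<rightleftharpoons> "CONST LAM A (\<lambda>x. B)"
  "\<Sigma> x : A. B" \<rightleftharpoons> "CONST SIG A (\<lambda>x. B)"

definition fun_ty :: "expr \<Rightarrow> expr \<Rightarrow> expr" (infixr "\<rightarrow>" 65) where
  "A \<rightarrow> B = (\<Pi> x : A. B)"

definition prod_ty :: "expr \<Rightarrow> expr \<Rightarrow> expr" (infixr "\<otimes>" 70) where
  "A \<otimes> B = (\<Sigma> x : A. B)"

text \<open>\<open>comp_on A f g\<close> is the composite of \<open>f\<close> after \<open>g\<close>, where \<open>A\<close> is the domain of \<open>g\<close>.\<close>

definition comp_on :: "expr \<Rightarrow> expr \<Rightarrow> expr \<Rightarrow> expr" where
  "comp_on A f g = (\<Lambda> x : A. f \<cdot> (g \<cdot> x))"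

text \<open>First projection from a Sigma-type with first component \<open>A\<close>.\<close>

definition proj1 :: "expr \<Rightarrow> expr \<Rightarrow> expr" where
  "proj1 A p = SPLIT (\<lambda>z. A) (\<lambda>x y. x) p"


text \<open>
  Everything below lives over the one-variable context \<open>E : \<U>\<close>; \<open>E\<close> is its variable, and
  \<open>emb t\<close> weakens a de Bruijn term \<open>t\<close> over this context to any longer one.
\<close>

definition ctxE :: ctx where
  "ctxE = [Univ 0]"

definition E :: expr where
  "E = var 0"

definition emb :: "tm \<Rightarrow> expr" where
  "emb t k = ren (\<lambda>n. n + (k - 1)) t"

definition ListS :: expr where
  "ListS = (\<Pi> X : \<U>. X \<rightarrow> (E \<rightarrow> X \<rightarrow> X) \<rightarrow> X)"

definition nilS :: expr where
  "nilS = (\<Lambda> X : \<U>. \<Lambda> x : X. \<Lambda> f : E \<rightarrow> X \<rightarrow> X. x)"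

definition consS :: "expr \<Rightarrow> expr \<Rightarrow> expr" where
  "consS e l = (\<Lambda> X : \<U>. \<Lambda> x : X. \<Lambda> f : E \<rightarrow> X \<rightarrow> X. f \<cdot> e \<cdot> (l \<cdot> X \<cdot> x \<cdot> f))"

definition recS :: "expr \<Rightarrow> expr \<Rightarrow> expr \<Rightarrow> expr \<Rightarrow> expr" where
  "recS X x g l = l \<cdot> X \<cdot> x \<cdot> g"

definition MorphList ::
    "expr \<Rightarrow> expr \<Rightarrow> expr \<Rightarrow> expr \<Rightarrow> expr \<Rightarrow> expr \<Rightarrow> expr \<Rightarrow> expr" where
  "MorphList X x g Y y h f =
     ID Y (f \<cdot> x) y \<otimes> (\<Pi> e : E. ID (X \<rightarrow> Y) (comp_on X f (g \<cdot> e)) (comp_on X (h \<cdot> e) f))"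

definition LimList :: "expr \<Rightarrow> expr" where
  "LimList l =
     (\<Pi> X : \<U>. \<Pi> Y : \<U>. \<Pi> x : X. \<Pi> y : Y. \<Pi> f : X \<rightarrow> Y. \<Pi> g : E \<rightarrow> X \<rightarrow> X. \<Pi> h : E \<rightarrow> Y \<rightarrow> Y.
        MorphList X x g Y y h f \<rightarrow> ID Y (f \<cdot> recS X x g l) (recS Y y h l))"

definition List :: expr where
  "List = (\<Sigma> l : ListS. LimList l)"

text \<open>
  \<open>nil\<close> and \<open>cons\<close> depend on proofs \<open>p0\<close> of \<open>LimNil\<close> and \<open>pc\<close> of \<open>LimCons\<close>, which are arbitrary
  de Bruijn terms of these types over the context \<open>E : \<U>\<close>.
\<close>

definition LimNil :: expr where
  "LimNil = LimList nilS"

definition LimCons :: expr where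
  "LimCons = (\<Pi> e : E. \<Pi> l : List. LimList (consS e (proj1 ListS l)))"

definition nil :: "tm \<Rightarrow> expr" where
  "nil p0 = \<langle>nilS, emb p0\<rangle>"

text \<open>
  \<open>cons\<close> and \<open>rec X x g\<close> occur unapplied as arguments, hence are internal functions.
\<close>

definition cons :: "tm \<Rightarrow> expr" where
  "cons pc = (\<Lambda> e : E. \<Lambda> l : List. \<langle>consS e (proj1 ListS l), emb pc \<cdot> e \<cdot> l\<rangle>)"

definition recL :: "expr \<Rightarrow> expr \<Rightarrow> expr \<Rightarrow> expr" where
  "recL X x g = (\<Lambda> l : List. recS X x g (proj1 ListS l))"

end

(*
  Let r = a List nil cons for an impredicative list a with a limit proof u.  Unfolding rec shows,
  by computation only, that rec X x g is a morphism from (List, nil, cons) to (X, x, g), so u at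
  this morphism gives rec X x g r = a X x g, that is, the first projection of r equals a, by
  function extensionality.  LimList a is a proposition (UIP and function extensionality), hence
  (a, u) = r.  Finally u at a given morphism f gives f r = a X x g, so f (a, u) = rec X x g (a, u).
*)

theory Submission
  imports Defs
begin

section \<open>Renamings and substitutions\<close>

text \<open>The limit condition makes a list a family natural in all algebras
  \<open>(X, x, g)\<close>, so \<open>List\<close> is the limit of the forgetful functor from
  algebras to types. Impredicativity puts this limit back into \<open>\<U>\<close>, hence it indexes
  one of its own components. The theorem is the uniqueness half of initiality, by the classical
  argument that such a limit is initial once its projection at itself is the identity;
  \<open>r\<close> is the value of that projection at \<open>(a, u)\<close>. The detour through
  \<open>r\<close> is forced: naturality at a morphism \<open>f\<close> out of \<open>List\<close>
  speaks about \<open>f r\<close> and not about \<open>f (a, u)\<close>. Two features of the object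
  theory shape the proof. \<open>Sig\<close> has no judgemental eta, so a list variable becomes a
  pair only by induction with \<open>Split\<close>. And it is renamings that are shown to preserve
  typing; substituted types are produced by rules such as \<open>ty_App\<close>, so lemmas are
  stated for arbitrary terms in an arbitrary context and reused at the variables of an extended
  context.\<close>

lemma up_simps [simp]: "up r 0 = 0" "up r (Suc n) = Suc (r n)"
  by (simp_all add: up_def)

lemma scons_simps [simp]: "(t \<bullet> s) 0 = t" "(t \<bullet> s) (Suc n) = s n"
  by (simp_all add: scons_def)

lemma ups_simps [simp]: "ups s 0 = Var 0" "ups s (Suc n) = shift (s n)"
  by (simp_all add: ups_def)

lemma up_comp: "up r \<circ> up q = up (r \<circ> q)"
  by (rule ext) (simp add: up_def split: nat.split)

lemma ren_ren: "ren r (ren q t) = ren (r \<circ> q) t"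
  by (induction t arbitrary: r q) (simp_all add: up_comp)

lemma ups_up: "ups s \<circ> up r = ups (s \<circ> r)"
  by (rule ext) (simp add: up_def ups_def scons_def split: nat.split)

lemma sub_ren: "sub s (ren r t) = sub (s \<circ> r) t"
  by (induction t arbitrary: r s) (simp_all add: ups_up)

lemma up_ups: "ren (up r) \<circ> ups s = ups (ren r \<circ> s)"
  by (rule ext) (simp add: ups_def scons_def ren_ren comp_def split: nat.split)

lemma ren_sub: "ren r (sub s t) = sub (ren r \<circ> s) t"
  by (induction t arbitrary: r s) (simp_all add: up_ups)

lemma ups_Var: "ups (\<lambda>n. Var (r n)) = (\<lambda>n. Var (up r n))"
  by (rule ext) (simp add: ups_def up_def scons_def split: nat.split)

lemma sub_Var_ren: "sub (\<lambda>n. Var (r n)) t = ren r t"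
  by (induction t arbitrary: r) (simp_all add: ups_Var)

lemma ren_id: "ren (\<lambda>n. n) t = t"
proof -
  have "up (\<lambda>n. n) = (\<lambda>n. n)"
    by (rule ext) (simp add: up_def split: nat.split)
  then show ?thesis by (induction t) simp_all
qed

lemma sub_Var [simp]: "sub Var t = t"
  using sub_Var_ren[of "\<lambda>n. n"] by (simp add: ren_id)

lemma ren_up_shift [simp]: "ren (up r) (shift t) = shift (ren r t)"
  by (simp add: ren_ren comp_def)

lemma sub_ups_shift [simp]: "sub (ups s) (shift t) = shift (sub s t)"
  by (simp add: sub_ren ren_sub comp_def)

lemma sub_scons_shift [simp]: "sub (a \<bullet> s) (shift t) = sub s t"
  by (simp add: sub_ren comp_def)

lemma sub_cong: "(\<And>n. s n = s' n) \<Longrightarrow> sub s t = sub s' t"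
  by (rule arg_cong[where f = "\<lambda>s. sub s t"]) (rule ext)

section \<open>Renaming commutes with instantiation and preserves typing\<close>

lemma ren_inst1: "ren r (inst1 B a) = inst1 (ren (up r) B) (ren r a)"
  by (simp add: ren_sub sub_ren)
    (rule sub_cong, simp add: scons_def up_def split: nat.split)

lemma ren_inst2: "ren r (inst2 B b a) = inst2 (ren (up (up r)) B) (ren r b) (ren r a)"
  by (simp add: ren_sub sub_ren)
    (rule sub_cong, simp add: scons_def up_def split: nat.split)

lemma ren_inst3:
  "ren r (inst3 B p b a) = inst3 (ren (up (up (up r))) B) (ren r p) (ren r b) (ren r a)"
  by (simp add: ren_sub sub_ren)
    (rule sub_cong, simp add: scons_def up_def split: nat.split)

lemma ren_split_ty: "ren (up (up r)) (split_ty C) = split_ty (ren (up r) C)"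
  by (simp add: split_ty_def ren_sub sub_ren)
    (rule sub_cong, simp add: scons_def up_def split: nat.split)

lemma ren_J_ty: "ren (up r) (J_ty C) = J_ty (ren (up (up (up r))) C)"
  by (simp add: J_ty_def ren_sub sub_ren)
    (rule sub_cong, simp add: scons_def up_def split: nat.split)

text \<open>Each variable goes to one whose type is literally the renamed type, both weakened to the
  whole context. Well-formedness of the target is included because the rules for variables and
  universes ask for it.\<close>

definition ren_ok :: "(nat \<Rightarrow> nat) \<Rightarrow> ctx \<Rightarrow> ctx \<Rightarrow> bool" where
  "ren_ok r \<Gamma> \<Delta> \<longleftrightarrow> wf_ctx \<Delta> \<and> (\<forall>n<length \<Gamma>. r n < length \<Delta> \<and>
     ren r (ren (\<lambda>m. m + Suc n) (\<Gamma> ! n)) = ren (\<lambda>m. m + Suc (r n)) (\<Delta> ! r n))"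

lemma ren_ok_up:
  assumes "ren_ok r \<Gamma> \<Delta>" "\<Delta> \<turnstile> ren r A : Univ i"
  shows "ren_ok (up r) (A # \<Gamma>) (ren r A # \<Delta>)"
proof -
  have "ren (up r) (ren (\<lambda>m. m + Suc (Suc n)) t) = shift (ren r (ren (\<lambda>m. m + Suc n) t))"
    "shift (ren (\<lambda>m. m + Suc n) t) = ren (\<lambda>m. m + Suc (Suc n)) t" for n t
    by (simp_all add: ren_ren comp_def)
  moreover have "ren (up r) (shift A) = shift (ren r A)" by simp
  ultimately show ?thesis
    using assms unfolding ren_ok_def
    by (auto simp: less_Suc_eq_0_disj ctx_cons)
qed

lemma ren_ok_shift:
  assumes "ren_ok r \<Gamma> \<Delta>" "\<Delta> \<turnstile> B : Univ i"
  shows "ren_ok (\<lambda>n. Suc (r n)) \<Gamma> (B # \<Delta>)"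
proof -
  have "ren (\<lambda>n. Suc (r n)) t = shift (ren r t)" for t by (simp add: ren_ren comp_def)
  moreover have "shift (ren (\<lambda>m. m + Suc n) t) = ren (\<lambda>m. m + Suc (Suc n)) t" for n t
    by (simp add: ren_ren comp_def)
  ultimately show ?thesis
    using assms unfolding ren_ok_def by (auto simp: ctx_cons)
qed

lemma ty_cumul_le: "\<Gamma> \<turnstile> A : Univ i \<Longrightarrow> i \<le> j \<Longrightarrow> \<Gamma> \<turnstile> A : Univ j"
  by (induction j) (auto simp: le_Suc_eq intro: ty_cumul)

text \<open>\<open>ty_Sig\<close> wants a common universe, whereas the premises of
  \<open>ty_Split\<close> place \<open>A\<close> and \<open>B\<close> in unrelated ones;
  cumulativity bridges the two.\<close>

lemma ty_Sig_max:
  assumes "\<Gamma> \<turnstile> A : Univ i" "A # \<Gamma> \<turnstile> B : Univ j"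
  shows "\<Gamma> \<turnstile> Sig A B : Univ (max i j)"
  by (rule ty_Sig) (rule assms[THEN ty_cumul_le], simp)+

lemma has_type_wf_ctx:
  "wf_ctx \<Gamma> \<Longrightarrow> True"
  "\<Gamma> \<turnstile> t : A \<Longrightarrow> wf_ctx \<Gamma>"
  "\<Gamma> \<turnstile> t \<equiv> t' : A \<Longrightarrow> wf_ctx \<Gamma>"
  by (induction rule: wf_ctx_has_type_eq_tm.inducts) simp_all

lemma ren_ok_Sig:
  assumes "ren_ok r \<Gamma> \<Delta>" "\<Delta> \<turnstile> ren r A : Univ i" "ren r A # \<Delta> \<turnstile> ren (up r) B : Univ j"
  shows "ren_ok (up r) (Sig A B # \<Gamma>) (Sig (ren r A) (ren (up r) B) # \<Delta>)"
  using ren_ok_up[OF assms(1), where A = "Sig A B"] ty_Sig_max[OF assms(2,3)] by simp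

text \<open>The target needs \<open>A\<close> under one and two extra declarations, but weakening is
  only a consequence of the induction that this lemma serves. Hence the second premise is the
  induction hypothesis for \<open>A\<close> at all renamings: at \<open>r\<close> followed by
  \<open>Suc\<close>, it yields the weakened type.\<close>

lemma ren_ok_J:
  assumes r: "ren_ok r \<Gamma> \<Delta>" and A: "\<forall>r \<Delta>. ren_ok r \<Gamma> \<Delta> \<longrightarrow> \<Delta> \<turnstile> ren r A : Univ i"
  shows "ren_ok (up (up (up r))) (Id (shift (shift A)) (Var (Suc 0)) (Var 0) # shift A # A # \<Gamma>)
    (Id (shift (shift (ren r A))) (Var (Suc 0)) (Var 0) # shift (ren r A) # ren r A # \<Delta>)"
proof -
  have shifts: "ren (\<lambda>n. Suc (r n)) A = shift (ren r A)"
    "ren (\<lambda>n. Suc (Suc (r n))) A = shift (shift (ren r A))"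
    by (simp_all add: ren_ren comp_def)
  have A0: "\<Delta> \<turnstile> ren r A : Univ i" using A r by blast
  note r1 = ren_ok_shift[OF r A0]
  have A1: "ren r A # \<Delta> \<turnstile> shift (ren r A) : Univ i"
    using A r1 unfolding shifts(1)[symmetric] by blast
  note r2 = ren_ok_shift[OF r1 A1]
  have A2: "shift (ren r A) # ren r A # \<Delta> \<turnstile> shift (shift (ren r A)) : Univ i"
    using A r2 unfolding shifts(2)[symmetric] by blast
  have wf: "wf_ctx (shift (ren r A) # ren r A # \<Delta>)" using r2 by (simp add: ren_ok_def)
  have v: "shift (ren r A) # ren r A # \<Delta> \<turnstile> Var (Suc 0) : shift (shift (ren r A))"
    "shift (ren r A) # ren r A # \<Delta> \<turnstile> Var 0 : shift (shift (ren r A))"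
    using ty_var[OF wf, of "Suc 0"] ty_var[OF wf, of 0] by (simp_all add: ren_ren comp_def)
  have "ren_ok (up (up r)) (shift A # A # \<Gamma>) (shift (ren r A) # ren r A # \<Delta>)"
    using ren_ok_up[OF ren_ok_up[OF r A0], of "shift A"] A1 by simp
  from ren_ok_up[OF this, of "Id (shift (shift A)) (Var (Suc 0)) (Var 0)"] show ?thesis
    using ty_Id[OF A2 v] by simp
qed

text \<open>The simplifier turns the index 1 inside \<open>J_ctx\<close> into \<open>Suc 0\<close>;
  these variants still match afterwards.\<close>

lemmas ty_J_Suc = ty_J[unfolded One_nat_def]
lemmas eq_J_Suc = eq_J[unfolded One_nat_def]
lemmas eq_J_Refl_Suc = eq_J_Refl[unfolded One_nat_def]
lemmas ren_simps = ren_inst1 ren_inst2 ren_inst3 ren_split_ty ren_J_ty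
lemmas ren_oks = ren_ok_up ren_ok_Sig ren_ok_J

text \<open>The renaming is quantified inside the induction because premises under binders are used
  at \<open>up r\<close>. Contexts carry the trivial claim \<open>True\<close>, since
  \<open>ren_ok\<close> already supplies a well-formed target.\<close>

lemma ren_typing:
  "wf_ctx \<Gamma> \<Longrightarrow> True"
  "\<Gamma> \<turnstile> t : A \<Longrightarrow> \<forall>r \<Delta>. ren_ok r \<Gamma> \<Delta> \<longrightarrow> \<Delta> \<turnstile> ren r t : ren r A"
  "\<Gamma> \<turnstile> t \<equiv> t' : A \<Longrightarrow> \<forall>r \<Delta>. ren_ok r \<Gamma> \<Delta> \<longrightarrow> \<Delta> \<turnstile> ren r t \<equiv> ren r t' : ren r A"
proof (induction rule: wf_ctx_has_type_eq_tm.inducts)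
  case (ty_var \<Gamma> n)
  then show ?case
    using Defs.ty_var unfolding ren_ok_def ren.simps by metis
next
  case ctx_nil
  show ?case by simp
next
  case ctx_cons
  show ?case by simp
next
  case ty_conv
  then show ?case
    by - ((simp add: ren_simps)?, intro allI impI, rule Defs.ty_conv,
      (blast intro: ren_oks)+)
next
  case ty_univ
  then show ?case by (simp add: ren_ok_def Defs.ty_univ)
next
  case ty_cumul
  then show ?case
    by - ((simp add: ren_simps)?, intro allI impI, rule Defs.ty_cumul,
      (blast intro: ren_oks)+)
next
  case ty_Pi
  then show ?case
    by - ((simp add: ren_simps)?, intro allI impI, rule Defs.ty_Pi,
      (blast intro: ren_oks)+)
next
  case ty_Pi_impred
  then show ?case
    by - ((simp add: ren_simps)?, intro allI impI, rule Defs.ty_Pi_impred,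
      (blast intro: ren_oks)+)
next
  case ty_Lam
  then show ?case
    by - ((simp add: ren_simps)?, intro allI impI, rule Defs.ty_Lam,
      (blast intro: ren_oks)+)
next
  case ty_App
  then show ?case
    by - ((simp add: ren_simps)?, intro allI impI, rule Defs.ty_App,
      (blast intro: ren_oks)+)
next
  case ty_Sig
  then show ?case
    by - ((simp add: ren_simps)?, intro allI impI, rule Defs.ty_Sig,
      (blast intro: ren_oks)+)
next
  case ty_Pair
  then show ?case
    by - ((simp add: ren_simps)?, intro allI impI, rule Defs.ty_Pair,
      (blast intro: ren_oks)+)
next
  \<comment> \<open>The induction hypothesis gives the branch the renamed \<open>split_ty\<close>,
    the rule asks for \<open>split_ty\<close> of the renamed motive; \<open>ren_split_ty\<close> is
    applied backwards to that premise alone. The cases for \<open>J\<close> treat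
    \<open>J_ty\<close> in the same way.\<close>
  case ty_Split
  then show ?case
    by - ((simp add: ren_simps)?, intro allI impI, rule Defs.ty_Split,
      (blast intro: ren_oks | (simp only: ren_split_ty[symmetric], blast intro: ren_oks))+)
next
  case ty_Id
  then show ?case
    by - ((simp add: ren_simps)?, intro allI impI, rule Defs.ty_Id,
      (blast intro: ren_oks)+)
next
  case ty_Refl
  then show ?case
    by - ((simp add: ren_simps)?, intro allI impI, rule Defs.ty_Refl,
      (blast intro: ren_oks)+)
next
  case ty_J
  then show ?case
    by - ((simp add: ren_simps)?, intro allI impI, rule ty_J_Suc,
      (blast intro: ren_oks | (simp only: ren_J_ty[symmetric], blast intro: ren_oks))+)
next
  case ty_Funext
  then show ?case
    by - ((simp add: ren_simps)?, intro allI impI, rule Defs.ty_Funext,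
      (blast intro: ren_oks)+)
next
  case ty_UIP
  then show ?case
    by - ((simp add: ren_simps)?, intro allI impI, rule Defs.ty_UIP,
      (blast intro: ren_oks)+)
next
  case eq_refl
  then show ?case
    by - ((simp add: ren_simps)?, intro allI impI, rule Defs.eq_refl,
      (blast intro: ren_oks)+)
next
  case eq_sym
  then show ?case
    by - ((simp add: ren_simps)?, intro allI impI, rule Defs.eq_sym,
      (blast intro: ren_oks)+)
next
  case eq_trans
  then show ?case
    by - ((simp add: ren_simps)?, intro allI impI, rule Defs.eq_trans,
      (blast intro: ren_oks)+)
next
  case eq_conv
  then show ?case
    by - ((simp add: ren_simps)?, intro allI impI, rule Defs.eq_conv,
      (blast intro: ren_oks)+)
next
  case eq_cumul
  then show ?case
    by - ((simp add: ren_simps)?, intro allI impI, rule Defs.eq_cumul,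
      (blast intro: ren_oks)+)
next
  case eq_beta
  then show ?case
    by - ((simp add: ren_simps)?, intro allI impI, rule Defs.eq_beta,
      (blast intro: ren_oks)+)
next
  case eq_eta
  then show ?case
    by - ((simp add: ren_simps)?, intro allI impI, rule Defs.eq_eta,
      (blast intro: ren_oks)+)
next
  case eq_Split_Pair
  then show ?case
    by - ((simp add: ren_simps)?, intro allI impI, rule Defs.eq_Split_Pair,
      (blast intro: ren_oks | (simp only: ren_split_ty[symmetric], blast intro: ren_oks))+)
next
  case eq_J_Refl
  then show ?case
    by - ((simp add: ren_simps)?, intro allI impI, rule eq_J_Refl_Suc,
      (blast intro: ren_oks | (simp only: ren_J_ty[symmetric], blast intro: ren_oks))+)
next
  case eq_Pi
  then show ?case
    by - ((simp add: ren_simps)?, intro allI impI, rule Defs.eq_Pi,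
      (blast intro: ren_oks)+)
next
  case eq_Pi_impred
  then show ?case
    by - ((simp add: ren_simps)?, intro allI impI, rule Defs.eq_Pi_impred,
      (blast intro: ren_oks)+)
next
  case eq_Lam
  then show ?case
    by - ((simp add: ren_simps)?, intro allI impI, rule Defs.eq_Lam,
      (blast intro: ren_oks)+)
next
  case eq_App
  then show ?case
    by - ((simp add: ren_simps)?, intro allI impI, rule Defs.eq_App,
      (blast intro: ren_oks)+)
next
  case eq_Sig
  then show ?case
    by - ((simp add: ren_simps)?, intro allI impI, rule Defs.eq_Sig,
      (blast intro: ren_oks)+)
next
  case eq_Pair
  then show ?case
    by - ((simp add: ren_simps)?, intro allI impI, rule Defs.eq_Pair,
      (blast intro: ren_oks)+)
next
  case eq_Split
  then show ?case
    by - ((simp add: ren_simps)?, intro allI impI, rule Defs.eq_Split,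
      (blast intro: ren_oks | (simp only: ren_split_ty[symmetric], blast intro: ren_oks))+)
next
  case eq_Id
  then show ?case
    by - ((simp add: ren_simps)?, intro allI impI, rule Defs.eq_Id,
      (blast intro: ren_oks)+)
next
  case eq_Refl
  then show ?case
    by - ((simp add: ren_simps)?, intro allI impI, rule Defs.eq_Refl,
      (blast intro: ren_oks)+)
next
  case eq_J
  then show ?case
    by - ((simp add: ren_simps)?, intro allI impI, rule eq_J_Suc,
      (blast intro: ren_oks | (simp only: ren_J_ty[symmetric], blast intro: ren_oks))+)
next
  case eq_Funext
  then show ?case
    by - ((simp add: ren_simps)?, intro allI impI, rule Defs.eq_Funext,
      (blast intro: ren_oks)+)
next
  case eq_UIP
  then show ?case
    by - ((simp add: ren_simps)?, intro allI impI, rule Defs.eq_UIP,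
      (blast intro: ren_oks)+)
qed

lemma ren_ok_Suc: "wf_ctx (B # \<Gamma>) \<Longrightarrow> ren_ok Suc \<Gamma> (B # \<Gamma>)"
  by (simp add: ren_ok_def ren_ren comp_def)

lemma wk: "\<Gamma> \<turnstile> t : A \<Longrightarrow> wf_ctx (B # \<Gamma>) \<Longrightarrow> B # \<Gamma> \<turnstile> shift t : shift A"
  using ren_typing(2) ren_ok_Suc by blast

lemma wk_univ: "\<Gamma> \<turnstile> A : Univ i \<Longrightarrow> wf_ctx (B # \<Gamma>) \<Longrightarrow> B # \<Gamma> \<turnstile> shift A : Univ i"
  using wk by fastforce

lemma ty_var0: "wf_ctx (A # \<Gamma>) \<Longrightarrow> A # \<Gamma> \<turnstile> Var 0 : shift A"
  using ty_var[of "A # \<Gamma>" 0] by simp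

lemma ty_var_Suc: "\<Gamma> \<turnstile> Var n : A \<Longrightarrow> wf_ctx (B # \<Gamma>) \<Longrightarrow> B # \<Gamma> \<turnstile> Var (Suc n) : shift A"
  using wk[of \<Gamma> "Var n"] by simp

section \<open>Inhabited types and transport\<close>

text \<open>The theorem asks only for the existence of a term, so proof terms are hidden and the
  rules read as natural deduction; terms occurring in types stay explicit.\<close>

definition inh :: "ctx \<Rightarrow> tm \<Rightarrow> bool" where
  "inh \<Gamma> A \<longleftrightarrow> (\<exists>t. \<Gamma> \<turnstile> t : A)"

lemma inhI: "\<Gamma> \<turnstile> t : A \<Longrightarrow> inh \<Gamma> A"
  by (auto simp: inh_def)

lemma inh_conv: "inh \<Gamma> A \<Longrightarrow> \<Gamma> \<turnstile> A \<equiv> B : Univ i \<Longrightarrow> inh \<Gamma> B"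
  unfolding inh_def by (blast intro: ty_conv)

text \<open>With the shift folded away, renaming and substitution distribute by
  \<open>arr_simps\<close>, and application returns the codomain itself instead of an instantiated
  one.\<close>

definition arr :: "tm \<Rightarrow> tm \<Rightarrow> tm" where
  "arr A B = Pi A (shift B)"

lemma arr_simps [simp]:
  "ren r (arr A B) = arr (ren r A) (ren r B)"
  "sub s (arr A B) = arr (sub s A) (sub s B)"
  by (simp_all add: arr_def)

lemma wf_ctxI: "\<Gamma> \<turnstile> A : Univ i \<Longrightarrow> wf_ctx (A # \<Gamma>)"
  by (blast intro: ctx_cons has_type_wf_ctx(2))

lemma arr_ty: "\<Gamma> \<turnstile> A : Univ i \<Longrightarrow> \<Gamma> \<turnstile> B : Univ 0 \<Longrightarrow> \<Gamma> \<turnstile> arr A B : Univ 0"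
  unfolding arr_def by (blast intro: ty_Pi_impred wk_univ wf_ctxI)

lemma arr_App: "\<Gamma> \<turnstile> f : arr A B \<Longrightarrow> \<Gamma> \<turnstile> a : A \<Longrightarrow> \<Gamma> \<turnstile> App f a : B"
  unfolding arr_def by (drule (1) ty_App) simp

lemma arr_App_cong:
  "\<Gamma> \<turnstile> f \<equiv> f' : arr A B \<Longrightarrow> \<Gamma> \<turnstile> a \<equiv> a' : A \<Longrightarrow> \<Gamma> \<turnstile> App f a \<equiv> App f' a' : B"
  unfolding arr_def by (drule (1) eq_App) simp

lemma arr_Lam: "\<Gamma> \<turnstile> A : Univ i \<Longrightarrow> A # \<Gamma> \<turnstile> b : shift B \<Longrightarrow> \<Gamma> \<turnstile> Lam A b : arr A B"
  unfolding arr_def by (rule ty_Lam)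

lemma inh_Pi: "\<Gamma> \<turnstile> A : Univ i \<Longrightarrow> inh (A # \<Gamma>) B \<Longrightarrow> inh \<Gamma> (Pi A B)"
  unfolding inh_def by (blast intro: ty_Lam)

lemma inh_arr: "\<Gamma> \<turnstile> A : Univ i \<Longrightarrow> inh (A # \<Gamma>) (shift B) \<Longrightarrow> inh \<Gamma> (arr A B)"
  unfolding arr_def by (rule inh_Pi)

lemma inh_App: "inh \<Gamma> (Pi A B) \<Longrightarrow> \<Gamma> \<turnstile> a : A \<Longrightarrow> inh \<Gamma> (inst1 B a)"
  unfolding inh_def by (blast intro: ty_App)

lemma inh_mp: "inh \<Gamma> (arr A B) \<Longrightarrow> inh \<Gamma> A \<Longrightarrow> inh \<Gamma> B"
  unfolding inh_def by (blast intro: arr_App)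

lemma inh_Split:
  assumes "\<Gamma> \<turnstile> A : Univ i" "A # \<Gamma> \<turnstile> B : Univ j" "Sig A B # \<Gamma> \<turnstile> C : Univ k"
    and "inh (B # A # \<Gamma>) (split_ty C)" "\<Gamma> \<turnstile> p : Sig A B"
  shows "inh \<Gamma> (inst1 C p)"
  using assms unfolding inh_def by (blast intro: ty_Split)

lemma inh_Funext:
  assumes "\<Gamma> \<turnstile> A : Univ i" "A # \<Gamma> \<turnstile> B : Univ j" "\<Gamma> \<turnstile> f : Pi A B" "\<Gamma> \<turnstile> g : Pi A B"
    and "inh (A # \<Gamma>) (Id B (App (shift f) (Var 0)) (App (shift g) (Var 0)))"
  shows "inh \<Gamma> (Id (Pi A B) f g)"
  using inh_Pi[OF assms(1,5)] assms(1-4) unfolding inh_def by (blast intro: ty_Funext)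

text \<open>
  The motive of the path induction is \<open>P[x] \<rightarrow> P[y]\<close>, over \<open>x : A, y : A, p : x = y\<close>; the
  renamings \<open>r1\<close> and \<open>r2\<close> send the variable of \<open>P\<close> to \<open>x\<close> and to \<open>y\<close>.
\<close>

lemma transport:
  assumes A: "\<Gamma> \<turnstile> A : Univ i" and P: "A # \<Gamma> \<turnstile> P : Univ 0"
    and a: "\<Gamma> \<turnstile> a : A" and b: "\<Gamma> \<turnstile> b : A" and p: "inh \<Gamma> (Id A a b)"
    and Pa: "inh \<Gamma> (inst1 P a)"
  shows "inh \<Gamma> (inst1 P b)"
proof -
  \<comment> \<open>\<open>ren_ok_J\<close> at the identity renaming yields the well-formedness of
    \<open>J_ctx A \<Gamma>\<close>.\<close>
  have ok: "ren_ok (\<lambda>n. n) \<Gamma> \<Gamma>"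
    using has_type_wf_ctx(2)[OF a] by (simp add: ren_ok_def ren_id)
  have A': "\<forall>r \<Delta>. ren_ok r \<Gamma> \<Delta> \<longrightarrow> \<Delta> \<turnstile> ren r A : Univ i"
    using ren_typing(2)[OF A] by simp
  have wfJ: "wf_ctx (J_ctx A \<Gamma>)"
    using ren_ok_J[OF ok A'] by (simp add: ren_ok_def ren_id)
  \<comment> \<open>In \<open>J_ctx A \<Gamma>\<close> the path has index 0, \<open>y\<close> index
    1 and \<open>x\<close> index 2, so the variables of \<open>\<Gamma>\<close> start at 3.\<close>
  define r1 r2 :: "nat \<Rightarrow> nat" where "r1 = case_nat 2 (\<lambda>m. m + 3)" and "r2 = case_nat 1 (\<lambda>m. m + 3)"
  have r: "ren_ok r1 (A # \<Gamma>) (J_ctx A \<Gamma>)" "ren_ok r2 (A # \<Gamma>) (J_ctx A \<Gamma>)"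
    using wfJ by (auto simp: ren_ok_def r1_def r2_def less_Suc_eq_0_disj ren_ren comp_def
        numeral_eq_Suc)
  have P1: "J_ctx A \<Gamma> \<turnstile> ren r1 P : Univ 0" and P2: "J_ctx A \<Gamma> \<turnstile> ren r2 P : Univ 0"
    using ren_typing(2)[OF P] r by auto
  let ?C = "arr (ren r1 P) (ren r2 P)"
  have "sub s (ren r1 P) = sub (\<lambda>n. s (r1 n)) P" "sub s (ren r2 P) = sub (\<lambda>n. s (r2 n)) P" for s
    by (simp_all add: sub_ren comp_def)
  moreover have "sub (\<lambda>n. (Refl (Var 0) \<bullet> Var 0 \<bullet> Var 0 \<bullet> (\<lambda>n. Var (Suc n))) (r1 n)) P = sub Var P"
    "sub (\<lambda>n. (Refl (Var 0) \<bullet> Var 0 \<bullet> Var 0 \<bullet> (\<lambda>n. Var (Suc n))) (r2 n)) P = sub Var P"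
    "sub (\<lambda>n. (t \<bullet> b \<bullet> a \<bullet> Var) (r1 n)) P = inst1 P a"
    "sub (\<lambda>n. (t \<bullet> b \<bullet> a \<bullet> Var) (r2 n)) P = inst1 P b" for t
    by (rule sub_cong, simp add: r1_def r2_def scons_def numeral_eq_Suc split: nat.split)+
  ultimately have C: "J_ty ?C = arr P P" "\<And>t. inst3 ?C t b a = arr (inst1 P a) (inst1 P b)"
    by (simp_all add: J_ty_def)
  \<comment> \<open>On the diagonal both renamings collapse and the motive becomes
    \<open>arr P P\<close>, so the identity function is the branch.\<close>
  have "A # \<Gamma> \<turnstile> Lam P (Var 0) : J_ty ?C"
    unfolding C by (blast intro: arr_Lam P ty_var0 wf_ctxI)
  then have "inh \<Gamma> (arr (inst1 P a) (inst1 P b))"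
    using p ty_J[OF A arr_ty[OF P1 P2] _ a b] unfolding inh_def C by blast
  then show ?thesis using Pa by (rule inh_mp)
qed

lemma inh_Refl: "\<Gamma> \<turnstile> A : Univ i \<Longrightarrow> \<Gamma> \<turnstile> a : A \<Longrightarrow> inh \<Gamma> (Id A a a)"
  by (blast intro: inhI ty_Refl)

lemma Id_sym:
  assumes A: "\<Gamma> \<turnstile> A : Univ 0" and a: "\<Gamma> \<turnstile> a : A" and b: "\<Gamma> \<turnstile> b : A" and p: "inh \<Gamma> (Id A a b)"
  shows "inh \<Gamma> (Id A b a)"
proof -
  have wf: "wf_ctx (A # \<Gamma>)" using A by (rule wf_ctxI)
  have "A # \<Gamma> \<turnstile> Id (shift A) (Var 0) (shift a) : Univ 0"
    by (blast intro: ty_Id wk_univ[OF A] wf ty_var0 wk[OF a])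
  from transport[OF A this a b p] inh_Refl[OF A a] show ?thesis by simp
qed

lemma Id_conv:
  assumes "\<Gamma> \<turnstile> A : Univ i" "inh \<Gamma> (Id A a b)" "\<Gamma> \<turnstile> a \<equiv> a' : A" "\<Gamma> \<turnstile> b \<equiv> b' : A"
  shows "inh \<Gamma> (Id A a' b')"
  using assms by (blast intro: inh_conv eq_Id eq_refl)

section \<open>Impredicative lists over an arbitrary type\<close>

text \<open>
  A constant whose name starts with \<open>t\<close> is the corresponding named-variable definition as a function
  of de Bruijn terms, with any term \<open>e\<close> in place of the variable \<open>E\<close> (\<open>tcomm\<close> is the second
    component
  of \<open>tMorph\<close>); it commutes with renaming and substitution.
\<close>

abbreviation app3 :: "tm \<Rightarrow> tm \<Rightarrow> tm \<Rightarrow> tm \<Rightarrow> tm" where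
  "app3 l X x g \<equiv> App (App (App l X) x) g"

definition alg :: "tm \<Rightarrow> tm \<Rightarrow> tm" where
  "alg e X = arr e (arr X X)"

definition tListS :: "tm \<Rightarrow> tm" where
  "tListS e = Pi (Univ 0) (arr (Var 0) (arr (alg (shift e) (Var 0)) (Var 0)))"

definition tnilS :: "tm \<Rightarrow> tm" where
  "tnilS e = Lam (Univ 0) (Lam (Var 0) (Lam (alg (shift (shift e)) (Var 1)) (Var 1)))"

definition tconsS :: "tm \<Rightarrow> tm \<Rightarrow> tm \<Rightarrow> tm" where
  "tconsS e a l = Lam (Univ 0) (Lam (Var 0) (Lam (alg (shift (shift e)) (Var 1))
     (App (App (Var 0) (shift (shift (shift a))))
       (app3 (shift (shift (shift l))) (Var 2) (Var 1) (Var 0)))))"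

definition tcomp :: "tm \<Rightarrow> tm \<Rightarrow> tm \<Rightarrow> tm" where
  "tcomp A f g = Lam A (App (shift f) (App (shift g) (Var 0)))"

definition tcomm :: "tm \<Rightarrow> tm \<Rightarrow> tm \<Rightarrow> tm \<Rightarrow> tm \<Rightarrow> tm \<Rightarrow> tm" where
  "tcomm e X g Y h f = Pi e (Id (arr (shift X) (shift Y))
     (tcomp (shift X) (shift f) (App (shift g) (Var 0)))
     (tcomp (shift X) (App (shift h) (Var 0)) (shift f)))"

definition tMorph :: "tm \<Rightarrow> tm \<Rightarrow> tm \<Rightarrow> tm \<Rightarrow> tm \<Rightarrow> tm \<Rightarrow> tm \<Rightarrow> tm \<Rightarrow> tm" where
  "tMorph e X x g Y y h f = Sig (Id Y (App f x) y) (shift (tcomm e X g Y h f))"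

abbreviation sh5 :: "tm \<Rightarrow> tm" where "sh5 t \<equiv> shift (shift (shift (shift (shift t))))"

text \<open>Naturality of \<open>l\<close> with respect to algebra morphisms: \<open>l\<close> picks
  a point of every algebra, compatibly with the morphisms, and is thus an element of a limit. Below
  the seven quantifiers the indices 6 down to 0 stand for \<open>X\<close>, \<open>Y\<close>,
  \<open>x\<close>, \<open>y\<close>, \<open>f\<close>, \<open>g\<close>, \<open>h\<close>; the
  morphism hypothesis enters by \<open>arr\<close> and takes no index.\<close>

definition tLim :: "tm \<Rightarrow> tm \<Rightarrow> tm" where
  "tLim e l = Pi (Univ 0) (Pi (Univ 0) (Pi (Var 1) (Pi (Var 1) (Pi (arr (Var 3) (Var 2))
     (Pi (alg (sh5 e) (Var 4)) (Pi (alg (shift (sh5 e)) (Var 4))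
       (arr (tMorph (shift (shift (sh5 e))) (Var 6) (Var 4) (Var 1) (Var 5) (Var 3) (Var 0) (Var 2))
         (Id (Var 5) (App (Var 2) (app3 (shift (shift (sh5 l))) (Var 6) (Var 4) (Var 1)))
           (app3 (shift (shift (sh5 l))) (Var 5) (Var 3) (Var 0))))))))))"

definition tList :: "tm \<Rightarrow> tm" where
  "tList e = Sig (tListS e) (tLim (shift e) (Var 0))"

definition tproj1 :: "tm \<Rightarrow> tm \<Rightarrow> tm" where
  "tproj1 A p = Split (shift A) (Var 1) p"

definition trec :: "tm \<Rightarrow> tm \<Rightarrow> tm \<Rightarrow> tm \<Rightarrow> tm" where
  "trec e X x g = Lam (tList e)
     (app3 (tproj1 (tListS (shift e)) (Var 0)) (shift X) (shift x) (shift g))"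

definition tcons :: "tm \<Rightarrow> tm \<Rightarrow> tm" where
  "tcons e pc = Lam e (Lam (tList (shift e))
     (Pair (tconsS (shift (shift e)) (Var 1) (tproj1 (tListS (shift (shift e))) (Var 0)))
       (App (App (shift (shift pc)) (Var 1)) (Var 0))))"

definition tLimCons :: "tm \<Rightarrow> tm" where
  "tLimCons e = Pi e (Pi (tList (shift e))
     (tLim (shift (shift e))
       (tconsS (shift (shift e)) (Var 1) (tproj1 (tListS (shift (shift e))) (Var 0)))))"

lemma alg_simps [simp]:
  "ren r (alg e X) = alg (ren r e) (ren r X)" "sub s (alg e X) = alg (sub s e) (sub s X)"
  by (simp_all add: alg_def)

lemma tListS_simps [simp]:
  "ren r (tListS e) = tListS (ren r e)" "sub s (tListS e) = tListS (sub s e)"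
  by (simp_all add: tListS_def)

lemma tnilS_simps [simp]:
  "ren r (tnilS e) = tnilS (ren r e)" "sub s (tnilS e) = tnilS (sub s e)"
  by (simp_all add: tnilS_def)

lemma tconsS_simps [simp]:
  "ren r (tconsS e a l) = tconsS (ren r e) (ren r a) (ren r l)"
  "sub s (tconsS e a l) = tconsS (sub s e) (sub s a) (sub s l)"
  by (simp_all add: tconsS_def numeral_eq_Suc)

lemma tcomp_simps [simp]:
  "ren r (tcomp A f g) = tcomp (ren r A) (ren r f) (ren r g)"
  "sub s (tcomp A f g) = tcomp (sub s A) (sub s f) (sub s g)"
  by (simp_all add: tcomp_def)

lemma tcomm_simps [simp]:
  "ren r (tcomm e X g Y h f) = tcomm (ren r e) (ren r X) (ren r g) (ren r Y) (ren r h) (ren r f)"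
  "sub s (tcomm e X g Y h f) = tcomm (sub s e) (sub s X) (sub s g) (sub s Y) (sub s h) (sub s f)"
  by (simp_all add: tcomm_def)

lemma tMorph_simps [simp]:
  "ren r (tMorph e X x g Y y h f) =
    tMorph (ren r e) (ren r X) (ren r x) (ren r g) (ren r Y) (ren r y) (ren r h) (ren r f)"
  "sub s (tMorph e X x g Y y h f) =
    tMorph (sub s e) (sub s X) (sub s x) (sub s g) (sub s Y) (sub s y) (sub s h) (sub s f)"
  by (simp_all add: tMorph_def)

lemma tLim_simps [simp]:
  "ren r (tLim e l) = tLim (ren r e) (ren r l)" "sub s (tLim e l) = tLim (sub s e) (sub s l)"
  by (simp_all add: tLim_def numeral_eq_Suc)

lemma tList_simps [simp]:
  "ren r (tList e) = tList (ren r e)" "sub s (tList e) = tList (sub s e)"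
  by (simp_all add: tList_def)

lemma tproj1_simps [simp]:
  "ren r (tproj1 A p) = tproj1 (ren r A) (ren r p)"
  "sub s (tproj1 A p) = tproj1 (sub s A) (sub s p)"
  by (simp_all add: tproj1_def)

lemma trec_simps [simp]:
  "ren r (trec e X x g) = trec (ren r e) (ren r X) (ren r x) (ren r g)"
  "sub s (trec e X x g) = trec (sub s e) (sub s X) (sub s x) (sub s g)"
  by (simp_all add: trec_def)

lemma tcons_simps [simp]:
  "ren r (tcons e pc) = tcons (ren r e) (ren r pc)"
  "sub s (tcons e pc) = tcons (sub s e) (sub s pc)"
  by (simp_all add: tcons_def)

lemma tLimCons_simps [simp]:
  "ren r (tLimCons e) = tLimCons (ren r e)" "sub s (tLimCons e) = tLimCons (sub s e)"
  by (simp_all add: tLimCons_def)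

text \<open>The simplifier turns variable indices into successor form.\<close>

lemmas tLim_Suc = tLim_def[unfolded eval_nat_numeral BitM.simps One_nat_def numeral_One]
lemmas tconsS_Suc = tconsS_def[unfolded eval_nat_numeral BitM.simps One_nat_def numeral_One]

section \<open>Typing of the encodings, and the limit condition as a proposition\<close>

lemma alg_ty: "\<Gamma> \<turnstile> e : Univ 0 \<Longrightarrow> \<Gamma> \<turnstile> X : Univ 0 \<Longrightarrow> \<Gamma> \<turnstile> alg e X : Univ 0"
  unfolding alg_def by (blast intro: arr_ty)

lemma wf_U: "wf_ctx \<Gamma> \<Longrightarrow> wf_ctx (Univ 0 # \<Gamma>)"
  by (blast intro: wf_ctxI ty_univ)

lemma tListS_ty:
  assumes e: "\<Gamma> \<turnstile> e : Univ 0"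
  shows "\<Gamma> \<turnstile> tListS e : Univ 0"
proof -
  have wf: "wf_ctx \<Gamma>" using e by (rule has_type_wf_ctx(2))
  have X: "Univ 0 # \<Gamma> \<turnstile> Var 0 : Univ 0" using ty_var0[OF wf_U[OF wf]] by simp
  note e' = wk_univ[OF e wf_U[OF wf]]
  show ?thesis unfolding tListS_def
    by (intro ty_Pi_impred[OF ty_univ[OF wf]] arr_ty[where i = 0] alg_ty X e')
qed

lemma tListS_app:
  assumes "\<Gamma> \<turnstile> l : tListS e" "\<Gamma> \<turnstile> X : Univ 0" "\<Gamma> \<turnstile> x : X" "\<Gamma> \<turnstile> g : alg e X"
  shows "\<Gamma> \<turnstile> app3 l X x g : X"
  using ty_App[OF assms(1)[unfolded tListS_def] assms(2)] assms(3,4)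
  by (auto intro: arr_App)

lemma tListS_app_cong:
  assumes "\<Gamma> \<turnstile> l \<equiv> l' : tListS e" "\<Gamma> \<turnstile> X : Univ 0" "\<Gamma> \<turnstile> x : X" "\<Gamma> \<turnstile> g : alg e X"
  shows "\<Gamma> \<turnstile> app3 l X x g \<equiv> app3 l' X x g : X"
  using eq_App[OF assms(1)[unfolded tListS_def] eq_refl[OF assms(2)]] assms(3,4)
  by (auto intro: arr_App_cong eq_refl)

lemma alg_app: "\<Gamma> \<turnstile> g : alg e X \<Longrightarrow> \<Gamma> \<turnstile> a : e \<Longrightarrow> \<Gamma> \<turnstile> App g a : arr X X"
  unfolding alg_def by (rule arr_App)

lemma tcomp_ty:
  assumes A: "\<Gamma> \<turnstile> A : Univ 0" and "\<Gamma> \<turnstile> f : arr B C" "\<Gamma> \<turnstile> g : arr A B"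
  shows "\<Gamma> \<turnstile> tcomp A f g : arr A C"
proof -
  note h = assms[THEN wk, OF wf_ctxI[OF A], simplified] ty_var0[OF wf_ctxI[OF A]]
  show ?thesis unfolding tcomp_def by (intro arr_Lam[OF A] arr_App[OF h(2)] arr_App[OF h(3)] h(4))
qed

lemma tcomm_ty:
  assumes e: "\<Gamma> \<turnstile> e : Univ 0" and h: "\<Gamma> \<turnstile> X : Univ 0" "\<Gamma> \<turnstile> g : alg e X"
    "\<Gamma> \<turnstile> Y : Univ 0" "\<Gamma> \<turnstile> h : alg e Y" "\<Gamma> \<turnstile> f : arr X Y"
  shows "\<Gamma> \<turnstile> tcomm e X g Y h f : Univ 0"
proof -
  note h = h[THEN wk, OF wf_ctxI[OF e], simplified] ty_var0[OF wf_ctxI[OF e]]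
  show ?thesis unfolding tcomm_def
    by (intro ty_Pi_impred[OF e] ty_Id arr_ty[where i = 0] tcomp_ty[OF h(1) h(5)] 
      tcomp_ty[OF h(1) alg_app[OF h(4)] h(5)] alg_app[OF h(2)] h)
qed

lemma tMorph_ty:
  assumes "\<Gamma> \<turnstile> e : Univ 0" and "\<Gamma> \<turnstile> X : Univ 0" "\<Gamma> \<turnstile> x : X" "\<Gamma> \<turnstile> g : alg e X"
    "\<Gamma> \<turnstile> Y : Univ 0" "\<Gamma> \<turnstile> y : Y" "\<Gamma> \<turnstile> h : alg e Y" "\<Gamma> \<turnstile> f : arr X Y"
  shows "\<Gamma> \<turnstile> tMorph e X x g Y y h f : Univ 0"
  unfolding tMorph_def using assms
  by (blast intro: ty_Sig wk_univ tcomm_ty wf_ctxI ty_Id arr_App)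

text \<open>The quantification over \<open>u\<close> and \<open>v\<close> is external and concerns
  terms over \<open>\<Gamma>\<close> alone. A product is therefore handled by asking for the
  property of its codomain over the extended context.\<close>

definition is_prop :: "ctx \<Rightarrow> tm \<Rightarrow> bool" where
  "is_prop \<Gamma> B \<longleftrightarrow> \<Gamma> \<turnstile> B : Univ 0 \<and>
     (\<forall>u v. \<Gamma> \<turnstile> u : B \<longrightarrow> \<Gamma> \<turnstile> v : B \<longrightarrow> inh \<Gamma> (Id B u v))"

lemma is_prop_Id:
  assumes "\<Gamma> \<turnstile> A : Univ 0" "\<Gamma> \<turnstile> a : A" "\<Gamma> \<turnstile> b : A"
  shows "is_prop \<Gamma> (Id A a b)"
  using assms unfolding is_prop_def by (blast intro: ty_Id inhI ty_UIP)

lemma is_prop_Pi: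
  assumes A: "\<Gamma> \<turnstile> A : Univ i" and B: "is_prop (A # \<Gamma>) B"
  shows "is_prop \<Gamma> (Pi A B)"
proof -
  have B': "A # \<Gamma> \<turnstile> B : Univ 0" using B by (simp add: is_prop_def)
  \<comment> \<open>Weakening \<open>u\<close> past \<open>A\<close> renames its codomain; applying
    it to the newest variable undoes that, so \<open>u\<close> at a generic argument has type
    \<open>B\<close> again.\<close>
  have "inst1 (ren (up Suc) B) (Var 0) = sub Var B"
    by (simp only: sub_ren) (rule sub_cong, simp add: scons_def up_def split: nat.split)
  then have "A # \<Gamma> \<turnstile> App (shift u) (Var 0) : B" if "\<Gamma> \<turnstile> u : Pi A B" for u
    using ty_App[OF _ ty_var0, of A \<Gamma> "shift u" "ren (up Suc) B"] wk[OF that] wf_ctxI[OF A] by simp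
  then show ?thesis
    using B A B' unfolding is_prop_def by (blast intro: ty_Pi_impred inh_Funext)
qed

lemma is_prop_arr_Id:
  assumes A: "\<Gamma> \<turnstile> A : Univ 0" and h: "\<Gamma> \<turnstile> C : Univ 0" "\<Gamma> \<turnstile> a : C" "\<Gamma> \<turnstile> b : C"
  shows "is_prop \<Gamma> (arr A (Id C a b))"
  unfolding arr_def using is_prop_Pi[OF A is_prop_Id] h[THEN wk, OF wf_ctxI[OF A]] by simp

lemma tLim_is_prop:
  assumes h: "\<Gamma> \<turnstile> e : Univ 0" "\<Gamma> \<turnstile> l : tListS e"
  shows "is_prop \<Gamma> (tLim e l)"
proof -
  have w: "wf_ctx \<Gamma>" using h(1) by (rule has_type_wf_ctx(2))
  \<comment> \<open>One block per quantifier of \<open>tLim\<close>: all facts are weakened and the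
    new variable is appended. In \<open>h7\<close> the facts 1 to 9 type \<open>e\<close>,
    \<open>l\<close>, \<open>X\<close>, \<open>Y\<close>, \<open>x\<close>, \<open>y\<close>,
    \<open>f\<close>, \<open>g\<close>, \<open>h\<close>.\<close>
  note w1 = wf_U[OF w]
  note h1 = h[THEN wk, OF w1, simplified] ty_var0[OF w1, simplified]
  note w2 = wf_U[OF w1]
  note h2 = h1[THEN wk, OF w2, simplified] ty_var0[OF w2, simplified]
  note w3 = wf_ctxI[OF h2(3)]
  note h3 = h2[THEN wk, OF w3, simplified] ty_var0[OF w3, simplified]
  note w4 = wf_ctxI[OF h3(4)]
  note h4 = h3[THEN wk, OF w4, simplified] ty_var0[OF w4, simplified]
  note t5 = arr_ty[OF h4(3,4)]
  note w5 = wf_ctxI[OF t5]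
  note h5 = h4[THEN wk, OF w5, simplified] ty_var0[OF w5, simplified]
  note t6 = alg_ty[OF h5(1,3)]
  note w6 = wf_ctxI[OF t6]
  note h6 = h5[THEN wk, OF w6, simplified] ty_var0[OF w6, simplified]
  note t7 = alg_ty[OF h6(1,4)]
  note w7 = wf_ctxI[OF t7]
  note h7 = h6[THEN wk, OF w7, simplified] ty_var0[OF w7, simplified]
  show ?thesis
    unfolding tLim_Suc
    by (rule is_prop_Pi[OF ty_univ[OF w]] is_prop_Pi[OF ty_univ[OF w1]] is_prop_Pi[OF h2(3)]
        is_prop_Pi[OF h3(4)] is_prop_Pi[OF t5] is_prop_Pi[OF t6] is_prop_Pi[OF t7]
        is_prop_arr_Id tMorph_ty arr_App tListS_app h7)+
qed

lemma tLim_ty: "\<Gamma> \<turnstile> e : Univ 0 \<Longrightarrow> \<Gamma> \<turnstile> l : tListS e \<Longrightarrow> \<Gamma> \<turnstile> tLim e l : Univ 0"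
  using tLim_is_prop by (simp add: is_prop_def)

lemma tLim_app:
  assumes u: "\<Gamma> \<turnstile> u : tLim e l" and X: "\<Gamma> \<turnstile> X : Univ 0" and Y: "\<Gamma> \<turnstile> Y : Univ 0"
    and x: "\<Gamma> \<turnstile> x : X" and y: "\<Gamma> \<turnstile> y : Y" and f: "\<Gamma> \<turnstile> f : arr X Y"
    and g: "\<Gamma> \<turnstile> g : alg e X" and h: "\<Gamma> \<turnstile> h : alg e Y"
    and m: "inh \<Gamma> (tMorph e X x g Y y h f)"
  shows "inh \<Gamma> (Id Y (App f (app3 l X x g)) (app3 l Y y h))"
proof -
  note 1 = inh_App[OF inhI[OF u[unfolded tLim_Suc]] X, simplified]
  note 2 = inh_App[OF 1 Y, simplified]
  note 3 = inh_App[OF 2 x, simplified]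
  note 4 = inh_App[OF 3 y, simplified]
  note 5 = inh_App[OF 4 f, simplified]
  note 6 = inh_App[OF 5 g, simplified]
  note 7 = inh_App[OF 6 h, simplified]
  show ?thesis by (rule inh_mp[OF 7 m])
qed

section \<open>Lists as a Sigma type and their first projection\<close>

lemma sub_Suc2: "sub (\<lambda>n. Var (Suc (Suc n))) t = shift (shift t)"
  using sub_Var_ren[of "\<lambda>n. Suc (Suc n)"] by (simp add: ren_ren comp_def)

lemma split_ty_shift: "split_ty (shift C) = shift (shift C)"
  by (simp add: split_ty_def sub_Suc2)

lemma
  assumes A: "\<Gamma> \<turnstile> A : Univ i" and B: "A # \<Gamma> \<turnstile> B : Univ i"
  shows tproj1_ty: "\<Gamma> \<turnstile> p : Sig A B \<Longrightarrow> \<Gamma> \<turnstile> tproj1 A p : A"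
    and tproj1_Pair: "\<Gamma> \<turnstile> a : A \<Longrightarrow> \<Gamma> \<turnstile> b : inst1 B a \<Longrightarrow> \<Gamma> \<turnstile> tproj1 A (Pair a b) \<equiv> a : A"
proof -
  have C: "Sig A B # \<Gamma> \<turnstile> shift A : Univ i"
    by (rule wk_univ[OF A wf_ctxI[OF ty_Sig[OF A B]]])
  have c: "B # A # \<Gamma> \<turnstile> Var 1 : split_ty (shift A)"
    using ty_var_Suc[OF ty_var0[OF wf_ctxI[OF A]] wf_ctxI[OF B]] by (simp add: split_ty_shift)
  show "\<Gamma> \<turnstile> tproj1 A p : A" if "\<Gamma> \<turnstile> p : Sig A B"
    using ty_Split[OF A B C c that] by (simp add: tproj1_def)
  show "\<Gamma> \<turnstile> tproj1 A (Pair a b) \<equiv> a : A" if "\<Gamma> \<turnstile> a : A" "\<Gamma> \<turnstile> b : inst1 B a"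
    using eq_Split_Pair[OF A B C c that] by (simp add: tproj1_def)
qed

abbreviation pr1 :: "tm \<Rightarrow> tm \<Rightarrow> tm" where
  "pr1 e l \<equiv> tproj1 (tListS e) l"

context
  fixes \<Gamma> e
  assumes e: "\<Gamma> \<turnstile> e : Univ 0"
begin

lemma tLim_var_ty: "tListS e # \<Gamma> \<turnstile> tLim (shift e) (Var 0) : Univ 0"
proof -
  note w = wf_ctxI[OF tListS_ty[OF e]]
  show ?thesis by (rule tLim_ty[OF wk_univ[OF e w]]) (use ty_var0[OF w] in simp)
qed

lemma tList_ty: "\<Gamma> \<turnstile> tList e : Univ 0"
  unfolding tList_def by (rule ty_Sig[OF tListS_ty[OF e] tLim_var_ty])

lemma tList_Pair: "\<Gamma> \<turnstile> a : tListS e \<Longrightarrow> \<Gamma> \<turnstile> u : tLim e a \<Longrightarrow> \<Gamma> \<turnstile> Pair a u : tList e"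
  unfolding tList_def by (rule ty_Pair[OF tListS_ty[OF e] tLim_var_ty]) simp_all

lemma pr1_ty: "\<Gamma> \<turnstile> l : tList e \<Longrightarrow> \<Gamma> \<turnstile> pr1 e l : tListS e"
  unfolding tList_def by (rule tproj1_ty[OF tListS_ty[OF e] tLim_var_ty])

lemma pr1_Pair:
  "\<Gamma> \<turnstile> a : tListS e \<Longrightarrow> \<Gamma> \<turnstile> u : tLim e a \<Longrightarrow> \<Gamma> \<turnstile> pr1 e (Pair a u) \<equiv> a : tListS e"
  by (rule tproj1_Pair[OF tListS_ty[OF e] tLim_var_ty]) simp_all

end

section \<open>Computation rules for nil, cons and rec, and rec as a morphism\<close>

lemma arr_beta:
  "\<Gamma> \<turnstile> A : Univ i \<Longrightarrow> A # \<Gamma> \<turnstile> b : shift B \<Longrightarrow> \<Gamma> \<turnstile> a : A \<Longrightarrow> \<Gamma> \<turnstile> App (Lam A b) a \<equiv> inst1 b a : B"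
  by (drule (2) eq_beta) simp

text \<open>The final digit in this family of names counts the arguments already filled in. Each
  stage is used twice: at a fresh variable it types the stage before it, and at an actual argument
  it is the premise of the next beta step.\<close>

lemma tnilS_ty2:
  assumes "\<Gamma> \<turnstile> e : Univ 0" "\<Gamma> \<turnstile> X : Univ 0" "\<Gamma> \<turnstile> x : X"
  shows "\<Gamma> \<turnstile> Lam (alg e X) (shift x) : arr (alg e X) X"
  by (rule arr_Lam[OF alg_ty[OF assms(1,2)] wk[OF assms(3) wf_ctxI[OF alg_ty[OF assms(1,2)]]]])

lemma tnilS_ty1:
  assumes e: "\<Gamma> \<turnstile> e : Univ 0" and X: "\<Gamma> \<turnstile> X : Univ 0"
  shows "\<Gamma> \<turnstile> Lam X (Lam (alg (shift e) (shift X)) (Var (Suc 0))) : arr X (arr (alg e X) X)"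
proof -
  note w = wf_ctxI[OF X]
  show ?thesis
    using tnilS_ty2[OF wk_univ[OF e w] wk_univ[OF X w] ty_var0[OF w]] arr_Lam[OF X] by simp
qed

lemma tnilS_ty:
  assumes e: "\<Gamma> \<turnstile> e : Univ 0"
  shows "\<Gamma> \<turnstile> tnilS e : tListS e"
proof -
  have wf: "wf_ctx \<Gamma>" using e by (rule has_type_wf_ctx(2))
  note w = wf_U[OF wf]
  show ?thesis unfolding tnilS_def tListS_def
    using tnilS_ty1[OF wk_univ[OF e w] ty_var0[OF w, simplified]] ty_Lam[OF ty_univ[OF wf]]
    by simp
qed

lemma tnilS_beta:
  assumes e: "\<Gamma> \<turnstile> e : Univ 0" and X: "\<Gamma> \<turnstile> X : Univ 0" and x: "\<Gamma> \<turnstile> x : X" and g: "\<Gamma> \<turnstile> g : alg e X"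
  shows "\<Gamma> \<turnstile> app3 (tnilS e) X x g \<equiv> x : X"
proof -
  have wf: "wf_ctx \<Gamma>" using e by (rule has_type_wf_ctx(2))
  note w = wf_U[OF wf] and wX = wf_ctxI[OF X] and A = alg_ty[OF e X]
  have "\<Gamma> \<turnstile> App (tnilS e) X \<equiv> Lam X (Lam (alg (shift e) (shift X)) (Var (Suc 0)))
      : arr X (arr (alg e X) X)"
    using eq_beta[OF ty_univ[OF wf] tnilS_ty1[OF wk_univ[OF e w] ty_var0[OF w, simplified]] X]
    by (simp add: tnilS_def)
  moreover have "\<Gamma> \<turnstile> App (Lam X (Lam (alg (shift e) (shift X)) (Var (Suc 0)))) x
      \<equiv> Lam (alg e X) (shift x) : arr (alg e X) X"
    using arr_beta[OF X _ x, where B = "arr (alg e X) X"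
        and b = "Lam (alg (shift e) (shift X)) (Var (Suc 0))"]
      tnilS_ty2[OF wk_univ[OF e wX] wk_univ[OF X wX] ty_var0[OF wX]] by simp
  moreover have "\<Gamma> \<turnstile> App (Lam (alg e X) (shift x)) g \<equiv> x : X"
    using arr_beta[OF A wk[OF x wf_ctxI[OF A]] g] by simp
  ultimately show ?thesis
    using x g by (blast intro: eq_trans arr_App_cong eq_refl)
qed

lemma tconsS_ty2:
  assumes "\<Gamma> \<turnstile> e : Univ 0" "\<Gamma> \<turnstile> a : e" "\<Gamma> \<turnstile> l : tListS e" "\<Gamma> \<turnstile> X : Univ 0" "\<Gamma> \<turnstile> x : X"
  shows "alg e X # \<Gamma> \<turnstile> App (App (Var 0) (shift a)) (app3 (shift l) (shift X) (shift x) (Var 0))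
    : shift X"
proof -
  note w = wf_ctxI[OF alg_ty[OF assms(1,4)]]
  note h = assms[THEN wk, OF w, simplified] ty_var0[OF w, simplified]
  show ?thesis by (rule arr_App alg_app tListS_app h)+
qed

lemma tconsS_ty1:
  assumes e: "\<Gamma> \<turnstile> e : Univ 0" and a: "\<Gamma> \<turnstile> a : e" and l: "\<Gamma> \<turnstile> l : tListS e" and X: "\<Gamma> \<turnstile> X : Univ 0"
  shows "X # \<Gamma> \<turnstile> Lam (alg (shift e) (shift X)) (App (App (Var 0) (shift (shift a)))
      (app3 (shift (shift l)) (shift (shift X)) (Var (Suc 0)) (Var 0))) : arr (alg (shift e) (shift
    X)) (shift X)"
proof -
  note w = wf_ctxI[OF X]
  note h = assms[THEN wk, OF w, simplified]
  show ?thesis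
    using arr_Lam[OF alg_ty[OF h(1,4)] tconsS_ty2[OF h ty_var0[OF w]]] by simp
qed

lemma tconsS_ty0:
  assumes e: "\<Gamma> \<turnstile> e : Univ 0" and a: "\<Gamma> \<turnstile> a : e" and l: "\<Gamma> \<turnstile> l : tListS e"
  shows "Univ 0 # \<Gamma> \<turnstile> Lam (Var 0) (Lam (alg (shift (shift e)) (Var (Suc 0)))
     (App (App (Var 0) (shift (shift (shift a))))
       (app3 (shift (shift (shift l))) (Var (Suc (Suc 0))) (Var (Suc 0)) (Var 0))))
     : arr (Var 0) (arr (alg (shift e) (Var 0)) (Var 0))"
proof -
  have wf: "wf_ctx \<Gamma>" using e by (rule has_type_wf_ctx(2))
  note w = wf_U[OF wf]
  note h = assms[THEN wk, OF w, simplified] ty_var0[OF w, simplified]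
  show ?thesis
    using arr_Lam[OF h(4)] tconsS_ty1[OF h] by simp
qed

lemma tconsS_ty:
  assumes "\<Gamma> \<turnstile> e : Univ 0" "\<Gamma> \<turnstile> a : e" "\<Gamma> \<turnstile> l : tListS e"
  shows "\<Gamma> \<turnstile> tconsS e a l : tListS e"
  unfolding tconsS_Suc tListS_def
  by (rule ty_Lam[OF ty_univ tconsS_ty0[OF assms]]) (rule has_type_wf_ctx(2)[OF assms(1)])

lemma tconsS_beta:
  assumes e: "\<Gamma> \<turnstile> e : Univ 0" and a: "\<Gamma> \<turnstile> a : e" and l: "\<Gamma> \<turnstile> l : tListS e"
    and X: "\<Gamma> \<turnstile> X : Univ 0" and x: "\<Gamma> \<turnstile> x : X" and g: "\<Gamma> \<turnstile> g : alg e X"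
  shows "\<Gamma> \<turnstile> app3 (tconsS e a l) X x g \<equiv> App (App g a) (app3 l X x g) : X"
proof -
  have wf: "wf_ctx \<Gamma>" using e by (rule has_type_wf_ctx(2))
  note A = alg_ty[OF e X]
  have "\<Gamma> \<turnstile> App (tconsS e a l) X \<equiv> Lam X (Lam (alg (shift e) (shift X)) (App (App (Var 0) (shift
      (shift a)))
      (app3 (shift (shift l)) (shift (shift X)) (Var (Suc 0)) (Var 0)))) : arr X (arr (alg e X) X)"
    using eq_beta[OF ty_univ[OF wf] tconsS_ty0[OF e a l] X] by (simp add: tconsS_Suc)
  moreover have "\<Gamma> \<turnstile> App (Lam X (Lam (alg (shift e) (shift X)) (App (App (Var 0) (shift (shift a)))
      (app3 (shift (shift l)) (shift (shift X)) (Var (Suc 0)) (Var 0))))) x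
      \<equiv> Lam (alg e X) (App (App (Var 0) (shift a)) (app3 (shift l) (shift X) (shift x) (Var 0)))
      : arr (alg e X) X"
    using arr_beta[OF X _ x, where B = "arr (alg e X) X"
        and b = "Lam (alg (shift e) (shift X)) (App (App (Var 0) (shift (shift a)))
          (app3 (shift (shift l)) (shift (shift X)) (Var (Suc 0)) (Var 0)))"]
      tconsS_ty1[OF e a l X] by simp
  moreover have "\<Gamma> \<turnstile> App (Lam (alg e X) (App (App (Var 0) (shift a))
      (app3 (shift l) (shift X) (shift x) (Var 0)))) g \<equiv> App (App g a) (app3 l X x g) : X"
    using arr_beta[OF A tconsS_ty2[OF e a l X x] g] by simp
  ultimately show ?thesis
    using x g by (blast intro: eq_trans arr_App_cong eq_refl)
qed

lemma trec_body_ty: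
  assumes e: "\<Gamma> \<turnstile> e : Univ 0" and h: "\<Gamma> \<turnstile> X : Univ 0" "\<Gamma> \<turnstile> x : X" "\<Gamma> \<turnstile> g : alg e X"
  shows "tList e # \<Gamma> \<turnstile> app3 (pr1 (shift e) (Var 0)) (shift X) (shift x) (shift g) : shift X"
proof -
  note w = wf_ctxI[OF tList_ty[OF e]]
  note h' = e[THEN wk, OF w, simplified] h[THEN wk, OF w, simplified] ty_var0[OF w, simplified]
  show ?thesis by (rule tListS_app pr1_ty h')+
qed

lemma trec_ty:
  assumes "\<Gamma> \<turnstile> e : Univ 0" "\<Gamma> \<turnstile> X : Univ 0" "\<Gamma> \<turnstile> x : X" "\<Gamma> \<turnstile> g : alg e X"
  shows "\<Gamma> \<turnstile> trec e X x g : arr (tList e) X"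
  unfolding trec_def using arr_Lam[OF tList_ty[OF assms(1)] trec_body_ty[OF assms]] by simp

lemma trec_beta:
  assumes "\<Gamma> \<turnstile> e : Univ 0" "\<Gamma> \<turnstile> X : Univ 0" "\<Gamma> \<turnstile> x : X" "\<Gamma> \<turnstile> g : alg e X" "\<Gamma> \<turnstile> l : tList e"
  shows "\<Gamma> \<turnstile> App (trec e X x g) l \<equiv> app3 (pr1 e l) X x g : X"
  unfolding trec_def
  using arr_beta[OF tList_ty[OF assms(1)] trec_body_ty[OF assms(1-4)] assms(5)] by simp

lemma tcons_ty2:
  assumes e: "\<Gamma> \<turnstile> e : Univ 0" and pc: "\<Gamma> \<turnstile> pc : tLimCons e" and a: "\<Gamma> \<turnstile> a : e"
    and l: "\<Gamma> \<turnstile> l : tList e"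
  shows "\<Gamma> \<turnstile> Pair (tconsS e a (pr1 e l)) (App (App pc a) l) : tList e"
    and "\<Gamma> \<turnstile> pr1 e (Pair (tconsS e a (pr1 e l)) (App (App pc a) l)) \<equiv> tconsS e a (pr1 e l)
        : tListS e"
proof -
  note c = tconsS_ty[OF e a pr1_ty[OF e l]]
  note 1 = ty_App[OF pc[unfolded tLimCons_def] a, simplified]
  have p: "\<Gamma> \<turnstile> App (App pc a) l : tLim e (tconsS e a (pr1 e l))"
    using ty_App[OF 1 l] by simp
  show "\<Gamma> \<turnstile> Pair (tconsS e a (pr1 e l)) (App (App pc a) l) : tList e"
    by (rule tList_Pair[OF e c p])
  show "\<Gamma> \<turnstile> pr1 e (Pair (tconsS e a (pr1 e l)) (App (App pc a) l)) \<equiv> tconsS e a (pr1 e l)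
      : tListS e"
    by (rule pr1_Pair[OF e c p])
qed

lemma tcons_ty1:
  assumes e: "\<Gamma> \<turnstile> e : Univ 0" and pc: "\<Gamma> \<turnstile> pc : tLimCons e" and a: "\<Gamma> \<turnstile> a : e"
  shows "tList e # \<Gamma> \<turnstile> Pair (tconsS (shift e) (shift a) (pr1 (shift e) (Var 0)))
    (App (App (shift pc) (shift a)) (Var 0)) : shift (tList e)"
proof -
  note w = wf_ctxI[OF tList_ty[OF e]]
  note h = assms[THEN wk, OF w, simplified] ty_var0[OF w, simplified]
  show ?thesis using tcons_ty2(1)[OF h] by simp
qed

lemma tcons_ty0:
  assumes e: "\<Gamma> \<turnstile> e : Univ 0" and pc: "\<Gamma> \<turnstile> pc : tLimCons e"
  shows "e # \<Gamma> \<turnstile> Lam (tList (shift e))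
     (Pair (tconsS (shift (shift e)) (Var 1) (pr1 (shift (shift e)) (Var 0)))
       (App (App (shift (shift pc)) (Var 1)) (Var 0))) : shift (arr (tList e) (tList e))"
proof -
  note w = wf_ctxI[OF e]
  note h = assms[THEN wk, OF w, simplified] ty_var0[OF w, simplified]
  show ?thesis using arr_Lam[OF tList_ty[OF h(1)] tcons_ty1[OF h]] by simp
qed

lemma tcons_ty:
  assumes "\<Gamma> \<turnstile> e : Univ 0" "\<Gamma> \<turnstile> pc : tLimCons e"
  shows "\<Gamma> \<turnstile> tcons e pc : alg e (tList e)"
  unfolding tcons_def alg_def by (rule arr_Lam[OF assms(1) tcons_ty0[OF assms]])

lemma tcons_beta:
  assumes e: "\<Gamma> \<turnstile> e : Univ 0" and pc: "\<Gamma> \<turnstile> pc : tLimCons e" and a: "\<Gamma> \<turnstile> a : e"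
    and l: "\<Gamma> \<turnstile> l : tList e"
  shows "\<Gamma> \<turnstile> App (App (tcons e pc) a) l \<equiv> Pair (tconsS e a (pr1 e l)) (App (App pc a) l) : tList e"
proof -
  have "\<Gamma> \<turnstile> App (tcons e pc) a \<equiv> Lam (tList e) (Pair (tconsS (shift e) (shift a) (pr1 (shift e)
      (Var 0)))
    (App (App (shift pc) (shift a)) (Var 0))) : arr (tList e) (tList e)"
    using arr_beta[OF e tcons_ty0[OF e pc] a] by (simp add: tcons_def)
  moreover have "\<Gamma> \<turnstile> App (Lam (tList e) (Pair (tconsS (shift e) (shift a) (pr1 (shift e) (Var 0)))
    (App (App (shift pc) (shift a)) (Var 0)))) l \<equiv> Pair (tconsS e a (pr1 e l)) (App (App pc a) l) :
    tList e"
    using arr_beta[OF tList_ty[OF e] tcons_ty1[OF e pc a] l] by simp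
  ultimately show ?thesis using l by (blast intro: eq_trans arr_App_cong eq_refl)
qed

lemma trec_nil:
  assumes "\<Gamma> \<turnstile> e : Univ 0" "\<Gamma> \<turnstile> X : Univ 0" "\<Gamma> \<turnstile> x : X" "\<Gamma> \<turnstile> g : alg e X"
    and p0: "\<Gamma> \<turnstile> p0 : tLim e (tnilS e)"
  shows "\<Gamma> \<turnstile> App (trec e X x g) (Pair (tnilS e) p0) \<equiv> x : X"
proof -
  note n = tnilS_ty[OF assms(1)]
  show ?thesis
    by (rule eq_trans[OF trec_beta[OF assms(1-4) tList_Pair[OF assms(1) n p0]]
        eq_trans[OF tListS_app_cong[OF pr1_Pair[OF assms(1) n p0] assms(2-4)] tnilS_beta[OF
    assms(1-4)]]])
qed

text \<open>The constructor produces an actual pair, so its projection reduces even if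
  \<open>l\<close> is a variable. That makes the equation judgemental for every \<open>l\<close>,
  which \<open>trec_comm\<close> exploits under a binder.\<close>

lemma trec_cons:
  assumes e: "\<Gamma> \<turnstile> e : Univ 0" and h: "\<Gamma> \<turnstile> X : Univ 0" "\<Gamma> \<turnstile> x : X" "\<Gamma> \<turnstile> g : alg e X"
    and pc: "\<Gamma> \<turnstile> pc : tLimCons e" and a: "\<Gamma> \<turnstile> a : e" and l: "\<Gamma> \<turnstile> l : tList e"
  shows "\<Gamma> \<turnstile> App (trec e X x g) (App (App (tcons e pc) a) l) \<equiv> App (App g a) (App (trec e X x g) l)
      : X"
proof -
  let ?c = "Pair (tconsS e a (pr1 e l)) (App (App pc a) l)"
  note l' = pr1_ty[OF e l] and ga = alg_app[OF h(3) a]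
  have "\<Gamma> \<turnstile> App (trec e X x g) (App (App (tcons e pc) a) l) \<equiv> App (trec e X x g) ?c : X"
    by (rule arr_App_cong[OF eq_refl[OF trec_ty[OF e h]] tcons_beta[OF e pc a l]])
  moreover have "\<Gamma> \<turnstile> App (trec e X x g) ?c \<equiv> app3 (pr1 e ?c) X x g : X"
    by (rule trec_beta[OF e h tcons_ty2(1)[OF e pc a l]])
  moreover have "\<Gamma> \<turnstile> app3 (pr1 e ?c) X x g \<equiv> app3 (tconsS e a (pr1 e l)) X x g : X"
    by (rule tListS_app_cong[OF tcons_ty2(2)[OF e pc a l] h])
  moreover have "\<Gamma> \<turnstile> app3 (tconsS e a (pr1 e l)) X x g \<equiv> App (App g a) (app3 (pr1 e l) X x g) : X"
    by (rule tconsS_beta[OF e a l' h])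
  moreover have "\<Gamma> \<turnstile> App (App g a) (app3 (pr1 e l) X x g) \<equiv> App (App g a) (App (trec e X x g) l)
      : X"
    by (rule arr_App_cong[OF eq_refl[OF ga] eq_sym[OF trec_beta[OF e h l]]])
  ultimately show ?thesis by (blast intro: eq_trans)
qed

text \<open>Both composites are abstractions over \<open>tList e\<close> whose bodies agree by
  \<open>trec_cons\<close> at the bound variable; congruence of \<open>Lam\<close> finishes.
  Reflexivity then proves the commutation clause of the morphism.\<close>

lemma trec_comm:
  assumes e: "\<Gamma> \<turnstile> e : Univ 0" and h: "\<Gamma> \<turnstile> X : Univ 0" "\<Gamma> \<turnstile> x : X" "\<Gamma> \<turnstile> g : alg e X"
    and pc: "\<Gamma> \<turnstile> pc : tLimCons e" and a: "\<Gamma> \<turnstile> a : e"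
  shows "\<Gamma> \<turnstile> tcomp (tList e) (trec e X x g) (App (tcons e pc) a)
    \<equiv> tcomp (tList e) (App g a) (trec e X x g) : arr (tList e) X"
proof -
  note L = tList_ty[OF e]
  note w = wf_ctxI[OF L]
  note h' = assms[THEN wk, OF w, simplified] ty_var0[OF w, simplified]
  show ?thesis unfolding tcomp_def arr_def
    using eq_Lam[OF L eq_refl[OF L] trec_cons[OF h']] by simp
qed

lemma inh_prod:
  assumes A: "\<Gamma> \<turnstile> A : Univ 0" and B: "\<Gamma> \<turnstile> B : Univ 0" and i: "inh \<Gamma> A" "inh \<Gamma> B"
  shows "inh \<Gamma> (Sig A (shift B))"
  using i ty_Pair[OF A wk_univ[OF B wf_ctxI[OF A]]] unfolding inh_def by fastforce

lemma trec_Morph: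
  assumes e: "\<Gamma> \<turnstile> e : Univ 0" and h: "\<Gamma> \<turnstile> X : Univ 0" "\<Gamma> \<turnstile> x : X" "\<Gamma> \<turnstile> g : alg e X"
    and pc: "\<Gamma> \<turnstile> pc : tLimCons e" and p0: "\<Gamma> \<turnstile> p0 : tLim e (tnilS e)"
  shows "inh \<Gamma> (tMorph e (tList e) (Pair (tnilS e) p0) (tcons e pc) X x g (trec e X x g))"
proof -
  note L = tList_ty[OF e] and n = tList_Pair[OF e tnilS_ty[OF e] p0] and r = trec_ty[OF e h]
  note w = wf_ctxI[OF e]
  note h' = e[THEN wk, OF w, simplified] h[THEN wk, OF w, simplified] pc[THEN wk, OF w, simplified]
     ty_var0[OF w, simplified]
  have "inh (e # \<Gamma>) (Id (arr (tList (shift e)) (shift X))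
     (tcomp (tList (shift e)) (trec (shift e) (shift X) (shift x) (shift g)) (App (tcons (shift e)
    (shift pc)) (Var 0)))
     (tcomp (tList (shift e)) (App (shift g) (Var 0)) (trec (shift e) (shift X) (shift x) (shift
    g))))"
    by (rule Id_conv[OF _ inh_Refl eq_refl trec_comm[OF h']])
      (rule arr_ty tcomp_ty tList_ty trec_ty alg_app[OF tcons_ty] h')+
  then have c: "inh \<Gamma> (tcomm e (tList e) (tcons e pc) X g (trec e X x g))"
    unfolding tcomm_def using inh_Pi[OF e] by simp
  have "inh \<Gamma> (Id X (App (trec e X x g) (Pair (tnilS e) p0)) x)"
    by (rule Id_conv[OF h(1) inh_Refl[OF h(1,2)] eq_sym[OF trec_nil[OF e h p0]] eq_refl[OF h(2)]])
  then show ?thesis unfolding tMorph_def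
    by (rule inh_prod[OF ty_Id[OF h(1) arr_App[OF r n] h(2)] tcomm_ty[OF e L tcons_ty[OF e pc]
    h(1,3) r] _ c])
qed

section \<open>Reflection and uniqueness\<close>

lemma inh_Funext_arr:
  assumes A: "\<Gamma> \<turnstile> A : Univ i" and B: "\<Gamma> \<turnstile> B : Univ j" and "\<Gamma> \<turnstile> f : arr A B" "\<Gamma> \<turnstile> g : arr A B"
    and "inh (A # \<Gamma>) (Id (shift B) (App (shift f) (Var 0)) (App (shift g) (Var 0)))"
  shows "inh \<Gamma> (Id (arr A B) f g)"
  using assms unfolding arr_def by (blast intro: inh_Funext wk_univ wf_ctxI)

text \<open>Function extensionality once for each of the arguments \<open>X\<close>,
  \<open>x\<close> and \<open>g\<close>. The outermost domain is \<open>Univ 0\<close>, itself a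
  type only in \<open>Univ 1\<close>.\<close>

lemma tListS_ext:
  assumes h: "\<Gamma> \<turnstile> e : Univ 0" "\<Gamma> \<turnstile> a : tListS e" "\<Gamma> \<turnstile> b : tListS e"
    and eq: "inh (alg (shift (shift e)) (Var 1) # Var 0 # Univ 0 # \<Gamma>)
      (Id (Var 2) (app3 (shift (shift (shift a))) (Var 2) (Var 1) (Var 0))
        (app3 (shift (shift (shift b))) (Var 2) (Var 1) (Var 0)))"
  shows "inh \<Gamma> (Id (tListS e) a b)"
proof -
  have w: "wf_ctx \<Gamma>" using h(1) by (rule has_type_wf_ctx(2))
  note w1 = wf_U[OF w]
  note h1 = h[THEN wk, OF w1, simplified] ty_var0[OF w1, simplified]
  note w2 = wf_ctxI[OF h1(4)]
  note h2 = h1[THEN wk, OF w2, simplified] ty_var0[OF w2, simplified]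
  note g2 = alg_ty[OF h2(1,4)] and g1 = alg_ty[OF h1(1,4)]
  note t1 = arr_ty[OF h1(4) arr_ty[OF g1 h1(4)]]
  note a1 = ty_App[OF h(2)[unfolded tListS_def, THEN wk, OF w1, simplified] ty_var0[OF w1,
    simplified], simplified]
  note b1 = ty_App[OF h(3)[unfolded tListS_def, THEN wk, OF w1, simplified] ty_var0[OF w1,
    simplified], simplified]
  note a2 = arr_App[OF a1[THEN wk, OF w2, simplified] h2(5)]
  note b2 = arr_App[OF b1[THEN wk, OF w2, simplified] h2(5)]
  show ?thesis
    unfolding tListS_def
    by (rule inh_Funext[OF ty_univ[OF w] t1 h(2,3)[unfolded tListS_def]],
      rule inh_Funext_arr[OF h1(4) arr_ty[OF g1 h1(4)] a1 b1])
      (use inh_Funext_arr[OF g2 h2(4) a2 b2] eq in \<open>simp add: numeral_eq_Suc\<close>)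
qed

text \<open>\<open>tLim_is_prop\<close> gives a path from \<open>u\<close> to \<open>v\<close>; the
  motive \<open>(a, u) = (a, z)\<close> is transported along it, starting from reflexivity.\<close>

lemma Pair_eq_snd:
  assumes e: "\<Gamma> \<turnstile> e : Univ 0" and a: "\<Gamma> \<turnstile> a : tListS e" and u: "\<Gamma> \<turnstile> u : tLim e a"
    and v: "\<Gamma> \<turnstile> v : tLim e a"
  shows "inh \<Gamma> (Id (tList e) (Pair a u) (Pair a v))"
proof -
  note A = tLim_ty[OF e a]
  note w = wf_ctxI[OF A]
  note h = e[THEN wk, OF w, simplified] a[THEN wk, OF w, simplified] u[THEN wk, OF w, simplified]
    ty_var0[OF w, simplified]
  have P: "tLim e a # \<Gamma> \<turnstile> Id (tList (shift e)) (Pair (shift a) (shift u)) (Pair (shift a) (Var 0))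
      : Univ 0"
    by (rule ty_Id[OF tList_ty[OF h(1)] tList_Pair[OF h(1-3)] tList_Pair[OF h(1,2,4)]])
  have p: "inh \<Gamma> (Id (tLim e a) u v)"
    using tLim_is_prop[OF e a] u v by (simp add: is_prop_def)
  show ?thesis
    using transport[OF A P u v p] inh_Refl[OF tList_ty[OF e] tList_Pair[OF e a u]] by simp
qed

text \<open>The type of \<open>v\<close> moves when \<open>a\<close> is replaced by
  \<open>b\<close>, so \<open>v\<close> cannot stay fixed during transport: the motive
  \<open>?P\<close> quantifies over all limit proofs of the endpoint and is instantiated with
  \<open>v\<close> at the end.\<close>

lemma Pair_eq:
  assumes e: "\<Gamma> \<turnstile> e : Univ 0" and a: "\<Gamma> \<turnstile> a : tListS e" and u: "\<Gamma> \<turnstile> u : tLim e a"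
    and b: "\<Gamma> \<turnstile> b : tListS e" and v: "\<Gamma> \<turnstile> v : tLim e b" and p: "inh \<Gamma> (Id (tListS e) a b)"
  shows "inh \<Gamma> (Id (tList e) (Pair a u) (Pair b v))"
proof -
  note A = tListS_ty[OF e]
  note w = wf_ctxI[OF A]
  note h = e[THEN wk, OF w, simplified] a[THEN wk, OF w, simplified] u[THEN wk, OF w, simplified]
    ty_var0[OF w, simplified]
  note L = tLim_ty[OF h(1,4)]
  note w2 = wf_ctxI[OF L]
  note h2 = h[THEN wk, OF w2, simplified] ty_var0[OF w2, simplified]
  let ?P = "Pi (tLim (shift e) (Var 0)) (Id (tList (shift (shift e)))
    (Pair (shift (shift a)) (shift (shift u))) (Pair (Var (Suc 0)) (Var 0)))"
  have P: "tListS e # \<Gamma> \<turnstile> ?P : Univ 0"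
    by (rule ty_Pi_impred[OF L ty_Id[OF tList_ty[OF h2(1)] tList_Pair[OF h2(1-3)] tList_Pair[OF
    h2(1,4,5)]]])
  note wa = wf_ctxI[OF tLim_ty[OF e a]]
  note ha = e[THEN wk, OF wa, simplified] a[THEN wk, OF wa, simplified] u[THEN wk, OF wa,
    simplified]
    ty_var0[OF wa, simplified]
  have "inh \<Gamma> (inst1 ?P a)"
    using inh_Pi[OF tLim_ty[OF e a] Pair_eq_snd[OF ha]] by simp
  from inh_App[OF transport[OF A P a b p this, simplified] v] show ?thesis by simp
qed

text \<open>The equation of first components is an internal hypothesis because this implication
  becomes a motive of \<open>Split\<close> in \<open>tList_eqI\<close>. On a pair the projection
  reduces, which leaves \<open>Pair_eq\<close>.\<close>

lemma Pair_eq_conv: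
  assumes e: "\<Gamma> \<turnstile> e : Univ 0" and a: "\<Gamma> \<turnstile> a : tListS e" and u: "\<Gamma> \<turnstile> u : tLim e a"
    and b: "\<Gamma> \<turnstile> b : tListS e" and v: "\<Gamma> \<turnstile> v : tLim e b"
  shows "inh \<Gamma> (arr (Id (tListS e) a (pr1 e (Pair b v))) (Id (tList e) (Pair a u) (Pair b v)))"
proof -
  have T: "\<Gamma> \<turnstile> Id (tListS e) a (pr1 e (Pair b v)) : Univ 0" (is "_ \<turnstile> ?T : _")
    by (rule ty_Id[OF tListS_ty[OF e] a pr1_ty[OF e tList_Pair[OF e b v]]])
  note w = wf_ctxI[OF T]
  note h = assms[THEN wk, OF w, simplified] ty_var0[OF w, simplified]
  have "inh (?T # \<Gamma>) (Id (tListS (shift e)) (shift a) (shift b))"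
    by (rule Id_conv[OF tListS_ty[OF h(1)] inhI[OF h(6)] eq_refl[OF h(2)] pr1_Pair[OF h(1,4,5)]])
  from inh_arr[OF T] Pair_eq[OF h(1-5) this] show ?thesis by simp
qed

text \<open>Without judgemental eta \<open>q\<close> need not be convertible to a pair, so the claim
  is proved for pairs and carried to \<open>q\<close> by \<open>Split\<close>.\<close>

lemma tList_eqI:
  assumes e: "\<Gamma> \<turnstile> e : Univ 0" and a: "\<Gamma> \<turnstile> a : tListS e" and u: "\<Gamma> \<turnstile> u : tLim e a"
    and q: "\<Gamma> \<turnstile> q : tList e" and p: "inh \<Gamma> (Id (tListS e) a (pr1 e q))"
  shows "inh \<Gamma> (Id (tList e) (Pair a u) q)"
proof -
  let ?C = "arr (Id (tListS (shift e)) (shift a) (pr1 (shift e) (Var 0)))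
    (Id (tList (shift e)) (Pair (shift a) (shift u)) (Var 0))"
  note A = tListS_ty[OF e] and B = tLim_var_ty[OF e]
  note w = wf_ctxI[OF tList_ty[OF e]]
  note h = e[THEN wk, OF w, simplified] a[THEN wk, OF w, simplified] u[THEN wk, OF w, simplified]
    ty_var0[OF w, simplified]
  have C: "tList e # \<Gamma> \<turnstile> ?C : Univ 0"
    by (rule arr_ty[where i = 0] ty_Id tListS_ty pr1_ty tList_ty tList_Pair h)+
  note w1 = wf_ctxI[OF A]
  note h1 = assms(1-3)[THEN wk, OF w1, simplified] ty_var0[OF w1, simplified]
  note w2 = wf_ctxI[OF B]
  note h2 = h1[THEN wk, OF w2, simplified] ty_var0[OF w2, simplified]
  have "inh (tLim (shift e) (Var 0) # tListS e # \<Gamma>) (split_ty ?C)"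
    using Pair_eq_conv[OF h2] by (simp add: split_ty_def sub_Suc2)
  from inh_Split[OF A B, folded tList_def, OF C this q]
  have "inh \<Gamma> (arr (Id (tListS e) a (pr1 e q)) (Id (tList e) (Pair a u) q))" by simp
  then show ?thesis using p by (rule inh_mp)
qed

section \<open>The reflection law and uniqueness of rec\<close>

lemma reflection_app:
  assumes e: "\<Gamma> \<turnstile> e : Univ 0" and pc: "\<Gamma> \<turnstile> pc : tLimCons e" and p0: "\<Gamma> \<turnstile> p0 : tLim e (tnilS e)"
    and a: "\<Gamma> \<turnstile> a : tListS e" and u: "\<Gamma> \<turnstile> u : tLim e a"
    and h: "\<Gamma> \<turnstile> X : Univ 0" "\<Gamma> \<turnstile> x : X" "\<Gamma> \<turnstile> g : alg e X"
  shows "inh \<Gamma> (Id X (app3 a X x g)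
    (app3 (pr1 e (app3 a (tList e) (Pair (tnilS e) p0) (tcons e pc))) X x g))"
proof -
  let ?r = "app3 a (tList e) (Pair (tnilS e) p0) (tcons e pc)"
  note L = tList_ty[OF e] and n = tList_Pair[OF e tnilS_ty[OF e] p0] and c = tcons_ty[OF e pc]
  note r = tListS_app[OF a L n c] and ax = tListS_app[OF a h]
  have "inh \<Gamma> (Id X (App (trec e X x g) ?r) (app3 a X x g))"
    by (rule tLim_app[OF u L h(1) n h(2) trec_ty[OF e h] c h(3) trec_Morph[OF e h pc p0]])
  then have "inh \<Gamma> (Id X (app3 (pr1 e ?r) X x g) (app3 a X x g))"
    using trec_beta[OF e h r] by (rule Id_conv[OF h(1)]) (rule eq_refl[OF ax])
  then show ?thesis
    by (rule Id_sym[OF h(1) tListS_app[OF pr1_ty[OF e r] h] ax])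
qed

text \<open>Rebuilding a list with its own constructors gives the list back. This is the theorem for
  the identity function; combined with naturality at \<open>f\<close> it yields the theorem for
  every other \<open>f\<close>.\<close>

lemma reflection:
  assumes e: "\<Gamma> \<turnstile> e : Univ 0" and pc: "\<Gamma> \<turnstile> pc : tLimCons e" and p0: "\<Gamma> \<turnstile> p0 : tLim e (tnilS e)"
    and a: "\<Gamma> \<turnstile> a : tListS e" and u: "\<Gamma> \<turnstile> u : tLim e a"
  shows "inh \<Gamma> (Id (tList e) (app3 a (tList e) (Pair (tnilS e) p0) (tcons e pc)) (Pair a u))"
proof -
  let ?r = "app3 a (tList e) (Pair (tnilS e) p0) (tcons e pc)"
  note L = tList_ty[OF e] and n = tList_Pair[OF e tnilS_ty[OF e] p0] and c = tcons_ty[OF e pc]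
  note r = tListS_app[OF a L n c]
  have w: "wf_ctx \<Gamma>" using e by (rule has_type_wf_ctx(2))
  note w1 = wf_U[OF w]
  note h1 = assms[THEN wk, OF w1, simplified] ty_var0[OF w1, simplified]
  note w2 = wf_ctxI[OF h1(6)]
  note h2 = h1[THEN wk, OF w2, simplified] ty_var0[OF w2, simplified]
  note w3 = wf_ctxI[OF alg_ty[OF h2(1,6)]]
  note h3 = h2[THEN wk, OF w3, simplified] ty_var0[OF w3, simplified]
  \<comment> \<open>\<open>reflection_app\<close> at the three newest variables is exactly the
    pointwise equation that \<open>tListS_ext\<close> demands.\<close>
  have "inh \<Gamma> (Id (tListS e) a (pr1 e ?r))"
    using tListS_ext[OF e a pr1_ty[OF e r]] reflection_app[OF h3] by (simp add: numeral_eq_Suc)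
  then have "inh \<Gamma> (Id (tList e) (Pair a u) ?r)"
    by (rule tList_eqI[OF e a u r])
  then show ?thesis by (rule Id_sym[OF L tList_Pair[OF e a u] r])
qed

lemma trec_unique_Pair:
  assumes e: "\<Gamma> \<turnstile> e : Univ 0" and pc: "\<Gamma> \<turnstile> pc : tLimCons e" and p0: "\<Gamma> \<turnstile> p0 : tLim e (tnilS e)"
    and h: "\<Gamma> \<turnstile> X : Univ 0" "\<Gamma> \<turnstile> x : X" "\<Gamma> \<turnstile> g : alg e X" and f: "\<Gamma> \<turnstile> f : arr (tList e) X"
    and m: "\<Gamma> \<turnstile> m : tMorph e (tList e) (Pair (tnilS e) p0) (tcons e pc) X x g f"
    and a: "\<Gamma> \<turnstile> a : tListS e" and u: "\<Gamma> \<turnstile> u : tLim e a"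
  shows "inh \<Gamma> (Id X (App f (Pair a u)) (App (trec e X x g) (Pair a u)))"
proof -
  let ?r = "app3 a (tList e) (Pair (tnilS e) p0) (tcons e pc)"
  note L = tList_ty[OF e] and n = tList_Pair[OF e tnilS_ty[OF e] p0] and c = tcons_ty[OF e pc]
  note r = tListS_app[OF a L n c] and au = tList_Pair[OF e a u] and ax = tListS_app[OF a h]
  have *: "inh \<Gamma> (Id X (App f ?r) (app3 a X x g))"
    by (rule tLim_app[OF u L h(1) n h(2) f c h(3) inhI[OF m]])
  note w = wf_ctxI[OF L]
  \<comment> \<open>The motive is \<open>f z = a X x g\<close> for a list \<open>z\<close>:
    naturality gives it at \<open>?r\<close>, and \<open>reflection\<close> carries it to
    \<open>Pair a u\<close>.\<close>
  have P: "tList e # \<Gamma> \<turnstile> Id (shift X) (App (shift f) (Var 0)) (shift (app3 a X x g)) : Univ 0"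
    by (rule ty_Id[OF wk_univ[OF h(1) w] arr_App[OF f[THEN wk, OF w, simplified] ty_var0[OF w,
    simplified]]
      wk[OF ax w]])
  have "inh \<Gamma> (Id X (App f (Pair a u)) (app3 a X x g))"
    using transport[OF L P r au reflection[OF e pc p0 a u]] * by simp
  then show ?thesis
    by (rule Id_conv[OF h(1) _ eq_refl[OF arr_App[OF f au]]])
      (rule eq_sym[OF eq_trans[OF trec_beta[OF e h au] tListS_app_cong[OF pr1_Pair[OF e a u] h]]])
qed

text \<open>The limit proof used for a list is its own second component, so \<open>Split\<close>
  must first expose \<open>l\<close> as a pair.\<close>

lemma trec_unique_app:
  assumes e: "\<Gamma> \<turnstile> e : Univ 0" and pc: "\<Gamma> \<turnstile> pc : tLimCons e" and p0: "\<Gamma> \<turnstile> p0 : tLim e (tnilS e)"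
    and h: "\<Gamma> \<turnstile> X : Univ 0" "\<Gamma> \<turnstile> x : X" "\<Gamma> \<turnstile> g : alg e X" and f: "\<Gamma> \<turnstile> f : arr (tList e) X"
    and m: "\<Gamma> \<turnstile> m : tMorph e (tList e) (Pair (tnilS e) p0) (tcons e pc) X x g f"
    and l: "\<Gamma> \<turnstile> l : tList e"
  shows "inh \<Gamma> (Id X (App f l) (App (trec e X x g) l))"
proof -
  let ?C = "Id (shift X) (App (shift f) (Var 0)) (App (shift (trec e X x g)) (Var 0))"
  note A = tListS_ty[OF e] and B = tLim_var_ty[OF e]
  note w = wf_ctxI[OF tList_ty[OF e]]
  have C: "tList e # \<Gamma> \<turnstile> ?C : Univ 0"
    by (rule ty_Id[OF wk_univ[OF h(1) w] arr_App[OF wk[OF f w, simplified] ty_var0[OF w,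
    simplified]]
      arr_App[OF wk[OF trec_ty[OF e h] w, simplified] ty_var0[OF w, simplified], folded
    trec_simps]])
  note w1 = wf_ctxI[OF A]
  note h1 = assms(1-8)[THEN wk, OF w1, simplified] ty_var0[OF w1, simplified]
  note w2 = wf_ctxI[OF B]
  note h2 = h1[THEN wk, OF w2, simplified] ty_var0[OF w2, simplified]
  have "inh (tLim (shift e) (Var 0) # tListS e # \<Gamma>) (split_ty ?C)"
    using trec_unique_Pair[OF h2] by (simp add: split_ty_def sub_Suc2)
  from inh_Split[OF A B, folded tList_def, OF C this l] show ?thesis by simp
qed

lemma trec_unique:
  assumes e: "\<Gamma> \<turnstile> e : Univ 0" and pc: "\<Gamma> \<turnstile> pc : tLimCons e" and p0: "\<Gamma> \<turnstile> p0 : tLim e (tnilS e)"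
    and h: "\<Gamma> \<turnstile> X : Univ 0" "\<Gamma> \<turnstile> x : X" "\<Gamma> \<turnstile> g : alg e X" and f: "\<Gamma> \<turnstile> f : arr (tList e) X"
    and m: "\<Gamma> \<turnstile> m : tMorph e (tList e) (Pair (tnilS e) p0) (tcons e pc) X x g f"
  shows "inh \<Gamma> (Id (arr (tList e) X) f (trec e X x g))"
proof -
  note L = tList_ty[OF e]
  note w = wf_ctxI[OF L]
  note h1 = assms[THEN wk, OF w, simplified] ty_var0[OF w, simplified]
  show ?thesis
    using inh_Funext_arr[OF L h(1) f trec_ty[OF e h]] trec_unique_app[OF h1] by simp
qed

section \<open>From named variables to de Bruijn terms\<close>

text \<open>An \<open>expr\<close> is any function of the depth, and nothing forces its value at a
  greater depth to be the weakened one. The threshold is there because a variable of level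
  \<open>l\<close> makes sense only at depths above \<open>l\<close>.\<close>

definition stable :: "nat \<Rightarrow> expr \<Rightarrow> bool" where
  "stable k t \<longleftrightarrow> (\<forall>j\<ge>k. t (Suc j) = shift (t j))"

lemma stable_Suc: "stable k t \<Longrightarrow> k \<le> j \<Longrightarrow> t (Suc j) = shift (t j)"
  by (simp add: stable_def)

lemma stable_var: "l < k \<Longrightarrow> stable k (var l)"
  by (simp add: stable_def var_def Suc_diff_Suc)

text \<open>Natural subtraction makes \<open>emb\<close> agree at depths 0 and 1, so shifting starts
  at depth 1.\<close>

lemma stable_emb: "0 < k \<Longrightarrow> stable k (emb p)"
  by (auto simp: stable_def emb_def ren_ren comp_def Suc_diff_le)

text \<open>\<open>E\<close> is the outermost declaration, hence has index \<open>k\<close> at depth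
  \<open>Suc k\<close>. Translating each constant at depth \<open>Suc k\<close> with
  \<open>Var k\<close> for \<open>E\<close> covers all depths at once.\<close>

lemma E_eq: "E (Suc k) = Var k"
  by (simp add: E_def var_def)

lemmas expr_defs = PI_def LAM_def APP_def SIG_def PAIR_def SPLIT_def ID_def UNIV0_def fun_ty_def
  prod_ty_def comp_on_def proj1_def recS_def

lemma ListS_eq: "ListS (Suc k) = tListS (Var k)"
  by (simp add: ListS_def tListS_def expr_defs E_eq alg_def arr_def var_def)

lemma nilS_eq: "nilS (Suc k) = tnilS (Var k)"
  by (simp add: nilS_def tnilS_def expr_defs E_eq alg_def arr_def var_def)

lemma consS_eq:
  assumes "stable (Suc k) a" "stable (Suc k) l"
  shows "consS a l (Suc k) = tconsS (Var k) (a (Suc k)) (l (Suc k))"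
  using assms[THEN stable_Suc]
  by (simp add: consS_def tconsS_Suc expr_defs E_eq alg_def arr_def var_def)

lemma MorphList_eq:
  assumes "stable (Suc k) X" "stable (Suc k) x" "stable (Suc k) g"
    "stable (Suc k) Y" "stable (Suc k) y" "stable (Suc k) h" "stable (Suc k) f"
  shows "MorphList X x g Y y h f (Suc k) = tMorph (Var k) (X (Suc k)) (x (Suc k)) (g (Suc k))
    (Y (Suc k)) (y (Suc k)) (h (Suc k)) (f (Suc k))"
  using assms[THEN stable_Suc]
  by (simp add: MorphList_def tMorph_def tcomm_def tcomp_def expr_defs E_eq arr_def var_def)

lemma LimList_eq:
  assumes "stable (Suc k) l"
  shows "LimList l (Suc k) = tLim (Var k) (l (Suc k))"
  using assms[THEN stable_Suc]
  \<comment> \<open>\<open>var\<close> stays folded while \<open>stable_var\<close> discharges the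
    side conditions; indices are computed afterwards.\<close>
  by (simp add: LimList_def tLim_Suc MorphList_eq stable_var expr_defs E_eq alg_def arr_def)
    (simp add: var_def numeral_eq_Suc)

lemma List_eq: "List (Suc k) = tList (Var k)"
  by (simp add: List_def tList_def SIG_def ListS_eq LimList_eq stable_var) (simp add: var_def)

lemma proj1_ListS_eq:
  "proj1 ListS l (Suc k) = pr1 (Var k) (l (Suc k))"
  by (simp add: proj1_def SPLIT_def ListS_eq tproj1_def var_def)

text \<open>Only positive depths remain to be checked, and those are the depths at which the
  translation lemmas apply.\<close>

lemma stableI: "(\<And>j. k \<le> j \<Longrightarrow> t (Suc (Suc j)) = shift (t (Suc j))) \<Longrightarrow> stable (Suc k) t"
  unfolding stable_def by (metis Suc_le_D Suc_le_mono)

lemma stable_mono: "stable k t \<Longrightarrow> k \<le> j \<Longrightarrow> stable j t"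
  by (simp add: stable_def)

lemma stable_List: "stable (Suc k) List"
  by (rule stableI) (simp add: List_eq)

lemma stable_nilS: "stable (Suc k) nilS"
  by (rule stableI) (simp add: nilS_eq)

lemma nil_eq: "nil p (Suc k) = Pair (tnilS (Var k)) (emb p (Suc k))"
  by (simp add: nil_def PAIR_def nilS_eq)

lemma stable_nil: "stable (Suc k) (nil p)"
  by (rule stableI) (simp add: nil_eq stable_emb[THEN stable_Suc, of "Suc 0"])

lemma stable_proj1: "stable (Suc k) l \<Longrightarrow> stable (Suc k) (proj1 ListS l)"
  by (rule stableI) (simp add: proj1_ListS_eq stable_Suc)

lemma stable_consS: "stable (Suc k) a \<Longrightarrow> stable (Suc k) l \<Longrightarrow> stable (Suc k) (consS a l)"
  by (rule stableI) (simp add: consS_eq stable_mono[of "Suc k"] stable_Suc)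

lemma cons_eq: "cons pc (Suc k) = tcons (Var k) (emb pc (Suc k))"
  using stable_emb[of "Suc k" pc, THEN stable_Suc]
  by (simp add: cons_def tcons_def LAM_def APP_def PAIR_def E_eq List_eq consS_eq stable_var
      stable_proj1 proj1_ListS_eq) (simp add: var_def)

lemma stable_cons: "stable (Suc k) (cons p)"
  by (rule stableI) (simp add: cons_eq stable_emb[THEN stable_Suc, of "Suc 0"])

lemma LimNil_eq: "LimNil (Suc k) = tLim (Var k) (tnilS (Var k))"
  by (simp add: LimNil_def LimList_eq stable_nilS nilS_eq)

lemma LimCons_eq: "LimCons (Suc k) = tLimCons (Var k)"
  by (simp add: LimCons_def tLimCons_def PI_def List_eq E_eq LimList_eq consS_eq stable_var
      stable_proj1 stable_consS proj1_ListS_eq) (simp add: var_def)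

lemma recL_eq:
  assumes "stable (Suc k) X" "stable (Suc k) x" "stable (Suc k) g"
  shows "recL X x g (Suc k) = trec (Var k) (X (Suc k)) (x (Suc k)) (g (Suc k))"
  using assms[THEN stable_Suc]
  by (simp add: recL_def trec_def LAM_def recS_def APP_def List_eq proj1_ListS_eq) (simp add:
    var_def)

text \<open>The index of \<open>E\<close> grows with each binder. The morphism hypothesis stands
  below \<open>E\<close>, \<open>X\<close>, \<open>x\<close>, \<open>g\<close> and \<open>f\<close>,
  hence the depth 5 in \<open>emb\<close>; the final equation lies one binder deeper.\<close>

lemma statement_eq:
  "(\<Pi> X : \<U>. \<Pi> x : X. \<Pi> g : E \<rightarrow> X \<rightarrow> X. \<Pi> f : List \<rightarrow> X.
       MorphList List (nil p0) (cons pc) X x g f \<rightarrow> ID (List \<rightarrow> X) f (recL X x g))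
    (Suc 0) =
   Pi (Univ 0) (Pi (Var 0) (Pi (alg (Var 2) (Var 1)) (Pi (arr (tList (Var 3)) (Var 2))
     (Pi (tMorph (Var 4) (tList (Var 4)) (Pair (tnilS (Var 4)) (emb p0 5)) (tcons (Var 4) (emb pc
    5))
        (Var 3) (Var 2) (Var 1) (Var 0))
      (Id (arr (tList (Var 5)) (Var 4)) (Var 1) (trec (Var 5) (Var 4) (Var 3) (Var 2)))))))"
  by (simp add: PI_def fun_ty_def ID_def UNIV0_def List_eq nil_eq cons_eq MorphList_eq
    stable_var stable_cons stable_nil stable_List recL_eq E_eq numeral_eq_Suc)
   (simp add: var_def alg_def arr_def List_eq numeral_eq_Suc)

theorem theorem4p3p9:
  fixes p0 pc :: tm
  assumes "ctxE \<turnstile> p0 : LimNil (length ctxE)"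
    and "ctxE \<turnstile> pc : LimCons (length ctxE)"
  shows "\<exists>t. ctxE \<turnstile> t :
    (\<Pi> X : \<U>. \<Pi> x : X. \<Pi> g : E \<rightarrow> X \<rightarrow> X. \<Pi> f : List \<rightarrow> X.
       MorphList List (nil p0) (cons pc) X x g f \<rightarrow> ID (List \<rightarrow> X) f (recL X x g))
    (length ctxE)"
proof -
  have len: "length ctxE = Suc 0" by (simp add: ctxE_def)
  have p0: "ctxE \<turnstile> p0 : tLim (Var 0) (tnilS (Var 0))" and pc: "ctxE \<turnstile> pc : tLimCons (Var 0)"
    using assms unfolding len LimNil_eq LimCons_eq by blast+
  note w = has_type_wf_ctx(2)[OF p0]
  have e: "ctxE \<turnstile> Var 0 : Univ 0"
    using ty_var0[of "Univ 0" "[]"] w by (simp add: ctxE_def)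
  note w1 = wf_U[OF w]
  \<comment> \<open>The facts follow the order of the premises of \<open>trec_unique\<close>, and
    each extension appends the newest variable, so \<open>h5\<close> discharges all eight
    premises.\<close>
  note h1 = e[THEN wk, OF w1, simplified] pc[THEN wk, OF w1, simplified]
    p0[THEN wk, OF w1, simplified] ty_var0[OF w1, simplified]
  note w2 = wf_ctxI[OF h1(4)]
  note h2 = h1[THEN wk, OF w2, simplified] ty_var0[OF w2, simplified]
  note t3 = alg_ty[OF h2(1,4)]
  note w3 = wf_ctxI[OF t3]
  note h3 = h2[THEN wk, OF w3, simplified] ty_var0[OF w3, simplified]
  note t4 = arr_ty[OF tList_ty[OF h3(1)] h3(4)]
  note w4 = wf_ctxI[OF t4]
  note h4 = h3[THEN wk, OF w4, simplified] ty_var0[OF w4, simplified]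
  note L4 = tList_ty[OF h4(1)]
  note t5 = tMorph_ty[OF h4(1) L4 tList_Pair[OF h4(1) tnilS_ty[OF h4(1)] h4(3)]
    tcons_ty[OF h4(1,2)] h4(4,5,6,7)]
  note w5 = wf_ctxI[OF t5]
  note h5 = h4[THEN wk, OF w5, simplified] ty_var0[OF w5, simplified]
  \<comment> \<open>\<open>t\<close> already lives over the one variable \<open>E\<close>, so depth
    5 means four shifts.\<close>
  have "emb t 5 = shift (shift (shift (shift t)))" for t
    by (simp add: emb_def ren_ren comp_def numeral_eq_Suc)
  then have "inh ctxE ((\<Pi> X : \<U>. \<Pi> x : X. \<Pi> g : E \<rightarrow> X \<rightarrow> X. \<Pi> f : List \<rightarrow> X.
       MorphList List (nil p0) (cons pc) X x g f \<rightarrow> ID (List \<rightarrow> X) f (recL X x g)) (Suc 0))"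
    unfolding statement_eq
    using inh_Pi[OF ty_univ[OF w] inh_Pi[OF h1(4) inh_Pi[OF t3 inh_Pi[OF t4 inh_Pi[OF t5
      trec_unique[OF h5]]]]]]
    by (simp add: numeral_eq_Suc)
  then show ?thesis unfolding inh_def len .
qed

end
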